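(* Let $n\in\mathbb{N}^+$ and let $K$ be a compact metric space with $\dim_T K\geq n$. Then for a generic $f\in C(K,\mathbb{R}^n)$ we have (i) $\#f^{-1}(y)\leq n$ if $y\in\partial f(K)$; (ii) $\#f^{-1}(y)=2^{\aleph_0}$ if $y\in\operatorname{int}f(K)$.
   Context: $\dim_T$ is the topological dimension (small inductive dimension: $\dim_T\emptyset=-1$ and $\dim_T X=\inf\{d: X$ has a basis $\mathcal{U}$ with $\dim_T\partial U\leq d-1$ for all $U\in\mathcal{U}\}$). $C(K,\mathbb{R}^n)$ is the complete metric space of continuous maps $K\to\mathbb{R}^n$ with the maximum norm. A property holds for a generic $f\in C(K,\mathbb{R}^n)$ if the set of $f$ having it is co-meager. $\partial f(K)$ and $\operatorname{int}f(K)$ are the boundary and interior of $f(K)$ in $\mathbb{R}^n$; $\#$ denotes cardinality. *)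

theory Defs
  imports "HOL-Analysis.Analysis"
begin

text \<open>
  The relation \<open>X dim_le d\<close> of the library is the recursive clause of the small inductive dimension;
  the value is the least such \<open>d\<close>, taken in the extended reals so that it is \<open>\<infinity>\<close> if there is none.
\<close>

definition small_inductive_dim :: "'a topology \<Rightarrow> ereal" where
  "small_inductive_dim X = Inf {ereal (of_int d) |d::int. X dim_le d}"

lemma small_inductive_dim_le_iff:
  "small_inductive_dim X \<le> ereal (of_int d) \<longleftrightarrow> X dim_le d"
proof
  assume "X dim_le d"
  then show "small_inductive_dim X \<le> ereal (of_int d)"
    unfolding small_inductive_dim_def by (intro Inf_lower) auto
next
  assume le: "small_inductive_dim X \<le> ereal (of_int d)"
  show "X dim_le d"
  proof (rule ccontr)
    assume nd: "\<not> X dim_le d"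
    have "ereal (of_int (d + 1)) \<le> small_inductive_dim X"
      unfolding small_inductive_dim_def
    proof (rule Inf_greatest)
      fix z assume "z \<in> {ereal (of_int d) |d::int. X dim_le d}"
      then obtain e :: int where e: "z = ereal (of_int e)" "X dim_le e" by blast
      have "d < e"
        using nd e(2) dimension_le_mono[of X e d] by (meson not_le)
      then have "d + 1 \<le> e" by simp
      then show "ereal (of_int (d + 1)) \<le> z"
        unfolding e(1) ereal_less_eq of_int_le_iff .
    qed
    with le have "ereal (of_int (d + 1)) \<le> ereal (of_int d)" by (rule order_trans[rotated])
    then show False by simp
  qed
qed

lemma small_inductive_dim_ge_minus1: "-1 \<le> small_inductive_dim X"
  unfolding small_inductive_dim_def
proof (rule Inf_greatest)
  fix z assume "z \<in> {ereal (of_int d) |d::int. X dim_le d}"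
  then obtain d :: int where d: "z = ereal (of_int d)" "X dim_le d" by blast
  have "-1 \<le> d" using dimension_le_bound[OF d(2)] .
  then have "-1 \<le> (of_int d :: real)" by linarith
  then show "-1 \<le> z" unfolding d(1) one_ereal_def by simp
qed

lemma small_inductive_dim_empty: "small_inductive_dim trivial_topology = -1"
proof (rule antisym)
  have "small_inductive_dim trivial_topology \<le> ereal (of_int (-1))"
    unfolding small_inductive_dim_le_iff by simp
  then show "small_inductive_dim trivial_topology \<le> -1"
    by (simp add: one_ereal_def)
qed (rule small_inductive_dim_ge_minus1)

lemma small_inductive_dim_recursion:
  fixes X :: "'a topology"
  assumes "X \<noteq> trivial_topology"
  shows "small_inductive_dim X =
    Inf {ereal (of_int d) |d::int. \<exists>\<U>. (\<forall>U\<in>\<U>. openin X U) \<and>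
          (\<forall>V x. openin X V \<and> x \<in> V \<longrightarrow> (\<exists>U\<in>\<U>. x \<in> U \<and> U \<subseteq> V)) \<and>
          (\<forall>U\<in>\<U>. small_inductive_dim (subtopology X (X frontier_of U)) \<le> ereal (of_int (d - 1)))}"
proof -
  have "X dim_le d \<longleftrightarrow> (\<exists>\<U>. (\<forall>U\<in>\<U>. openin X U) \<and>
          (\<forall>V x. openin X V \<and> x \<in> V \<longrightarrow> (\<exists>U\<in>\<U>. x \<in> U \<and> U \<subseteq> V)) \<and>
          (\<forall>U\<in>\<U>. (subtopology X (X frontier_of U)) dim_le (d - 1)))" (is "_ \<longleftrightarrow> ?R") for d
  proof
    assume "X dim_le d"
    then have *: "\<And>V a. \<lbrakk>openin X V; a \<in> V\<rbrakk> \<Longrightarrow>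
        \<exists>U. a \<in> U \<and> U \<subseteq> V \<and> openin X U \<and> (subtopology X (X frontier_of U)) dim_le (d-1)"
      by (cases rule: dimension_le.cases) blast
    show ?R
    proof (intro exI conjI)
      show "\<forall>V x. openin X V \<and> x \<in> V \<longrightarrow>
          (\<exists>U\<in>{U. openin X U \<and> (subtopology X (X frontier_of U)) dim_le (d-1)}. x \<in> U \<and> U \<subseteq> V)"
        using * by blast
    qed auto
  next
    assume ?R
    then obtain \<U> where B: "\<forall>U\<in>\<U>. openin X U"
      "\<forall>V x. openin X V \<and> x \<in> V \<longrightarrow> (\<exists>U\<in>\<U>. x \<in> U \<and> U \<subseteq> V)"
      "\<forall>U\<in>\<U>. (subtopology X (X frontier_of U)) dim_le (d - 1)" by blast
    obtain x where "x \<in> topspace X" using assms by (metis ex_in_conv null_topspace_iff_trivial)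
    then obtain U where "U \<in> \<U>" using B(2) openin_topspace[of X] by meson
    then have "-1 \<le> d - 1" using B(3) by (meson dimension_le_bound)
    then have "-1 \<le> d" by simp
    then show "X dim_le d"
    proof (rule dimension_le.intros)
      fix V a assume "openin X V" "a \<in> V"
      then obtain U where "U \<in> \<U>" "a \<in> U" "U \<subseteq> V" using B(2) by meson
      with B(1,3) show "\<exists>U. a \<in> U \<and> U \<subseteq> V \<and> openin X U \<and>
          (subtopology X (X frontier_of U)) dim_le (d - 1)" by auto
    qed
  qed
  note eq = this
  show ?thesis
    unfolding small_inductive_dim_le_iff small_inductive_dim_def[of X] eq ..
qed

definition nowhere_dense_in :: "'a topology \<Rightarrow> 'a set \<Rightarrow> bool" where
  "nowhere_dense_in X S \<longleftrightarrow> S \<subseteq> topspace X \<and> X interior_of (X closure_of S) = {}"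

definition meager_in :: "'a topology \<Rightarrow> 'a set \<Rightarrow> bool" where
  "meager_in X S \<longleftrightarrow> (\<exists>N::nat \<Rightarrow> 'a set. (\<forall>i. nowhere_dense_in X (N i)) \<and> S = (\<Union>i. N i))"

definition comeager_in :: "'a topology \<Rightarrow> 'a set \<Rightarrow> bool" where
  "comeager_in X S \<longleftrightarrow> S \<subseteq> topspace X \<and> meager_in X (topspace X - S)"

definition generic_in :: "'a topology \<Rightarrow> ('a \<Rightarrow> bool) \<Rightarrow> bool" where
  "generic_in X P \<longleftrightarrow> comeager_in X {x \<in> topspace X. P x}"

text \<open>Elements of \<open>cfunspace\<close> are total functions, \<open>undefined\<close> outside the carrier, so the fibre is cut down to it.\<close>

definition fibre :: "'a metric \<Rightarrow> ('a \<Rightarrow> 'b) \<Rightarrow> 'b \<Rightarrow> 'a set" where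
  "fibre K f y = {x \<in> mspace K. f x = y}"

end

theory Submission
  imports Defs
begin

text \<open>
  Call \<open>y\<close> a stable value of \<open>f\<close> on \<open>C\<close> if every map uniformly close to \<open>f\<close> on \<open>C\<close> attains \<open>y\<close> on \<open>C\<close>.
  A small perturbation makes each of finitely many grid points either stable or avoided.
  Composing with a coordinatewise zigzag then stretches a tiny cube around each grid point
  over a whole grid cell, so that stability spreads to the cell; for an avoided grid point the same map,
  chosen without overshoot, pushes the image out of the interior of the cell.

  This yields three properties of generic \<open>f\<close>. With overshoot, the stretched cells cover, and every
  interior value becomes stable. With more overshoot, each value is covered by two stretched cells, so
  a stable value on \<open>C\<close> is stable on two disjoint closed subsets of \<open>C\<close>, and a Cantor scheme gives
  continuum many preimages. Without overshoot, on \<open>n+1\<close> disjoint closed sets with mutually shifted grids,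
  an unstable common value would lie close to a cell wall of each of the \<open>n+1\<close> grids, hence, by the
  pigeonhole principle, close to walls of two different grids orthogonal to the same one of the \<open>n\<close> axes, which is
  impossible; so a value with \<open>n+1\<close> preimages is stable and therefore interior.
\<close>

section \<open>Stable values\<close>

lemma continuous_map_compose_UNIV:
  assumes "continuous_map X euclidean f" "continuous_on UNIV F"
  shows "continuous_map X euclidean (\<lambda>x. F (f x))"
  using continuous_map_compose[OF assms(1), of euclidean F] assms(2) by (simp add: o_def)

lemma continuous_map_scaleR:
  fixes f :: "'a \<Rightarrow> 'b::real_normed_vector"
  assumes "continuous_map X euclideanreal u" "continuous_map X euclidean f"
  shows "continuous_map X euclidean (\<lambda>x. u x *\<^sub>R f x)"
proof -
  have "continuous_map X euclidean (\<lambda>x. (u x, f x))"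
    using continuous_map_pairedI[OF assms] by simp
  moreover have "continuous_on UNIV (\<lambda>p::real \<times> 'b. fst p *\<^sub>R snd p)"
    by (intro continuous_intros)
  ultimately show ?thesis
    using continuous_map_compose_UNIV[of X "\<lambda>x. (u x, f x)" "\<lambda>p. fst p *\<^sub>R snd p"] by simp
qed

lemma continuous_on_vec_map:
  fixes \<psi> :: "real \<Rightarrow> real"
  assumes "continuous_on UNIV \<psi>"
  shows "continuous_on UNIV (\<lambda>p::real^'n::finite. \<chi> j. \<psi> (p $ j))"
  by (intro continuous_on_vec_lambda continuous_on_compose2[OF assms] continuous_intros) auto

text \<open>Distances are compared coordinate by coordinate because the zigzag maps act on each
  coordinate separately; the norm differs from this by at most a factor
  \<open>CARD('n)\<close>.\<close>

definition near :: "'a set \<Rightarrow> real \<Rightarrow> ('a \<Rightarrow> real^'n) \<Rightarrow> ('a \<Rightarrow> real^'n) \<Rightarrow> bool" where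
  "near C d f g \<longleftrightarrow> (\<forall>x\<in>C. \<forall>j. \<bar>f x $ j - g x $ j\<bar> \<le> d)"

lemma nearD: "near C d f g \<Longrightarrow> x \<in> C \<Longrightarrow> \<bar>f x $ j - g x $ j\<bar> \<le> d"
  by (simp add: near_def)

lemma near_mono: "near C d f g \<Longrightarrow> C' \<subseteq> C \<Longrightarrow> d \<le> d' \<Longrightarrow> near C' d' f g"
  unfolding near_def using order_trans by blast

lemma near_sym: "near C d f g \<Longrightarrow> near C d g f"
  by (simp add: near_def abs_minus_commute)

lemma near_trans: "near C a f g \<Longrightarrow> near C b g h \<Longrightarrow> near C (a + b) f h"
proof -
  assume fg: "near C a f g" and gh: "near C b g h"
  have "\<bar>f x $ j - h x $ j\<bar> \<le> a + b" if "x \<in> C" for x j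
    using nearD[OF fg that, of j] nearD[OF gh that, of j] by linarith
  then show ?thesis by (simp add: near_def)
qed

text \<open>Competitors \<open>h\<close> are continuous on the whole space but compared with
  \<open>f\<close> only on \<open>C\<close>. The radius \<open>d\<close> is an explicit argument so
  that every loss of stability can be accounted for.\<close>

definition stable_value ::
    "'a topology \<Rightarrow> ('a \<Rightarrow> real^'n) \<Rightarrow> 'a set \<Rightarrow> real^'n \<Rightarrow> real \<Rightarrow> bool" where
  "stable_value X f C y d \<longleftrightarrow>
     (\<forall>h. continuous_map X euclidean h \<and> near C d f h \<longrightarrow> y \<in> h ` C)"

lemma stable_valueD:
  "stable_value X f C y d \<Longrightarrow> continuous_map X euclidean h \<Longrightarrow> near C d f h \<Longrightarrow> y \<in> h ` C"
  by (simp add: stable_value_def)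

lemma stable_value_mono:
  "stable_value X f C y d \<Longrightarrow> C \<subseteq> C' \<Longrightarrow> d' \<le> d \<Longrightarrow> stable_value X f C' y d'"
  unfolding stable_value_def using near_mono[of C' d' f _ C d] image_mono[of C C'] by blast

lemma stable_value_perturb:
  assumes "stable_value X f C y d" "near C a f g" "b \<le> d - a"
  shows "stable_value X g C y b"
  unfolding stable_value_def
proof (intro allI impI)
  fix h assume h: "continuous_map X euclidean h \<and> near C b g h"
  have "near C d f h"
    by (rule near_mono[OF near_trans[OF assms(2) conjunct2[OF h]] order_refl]) (use assms(3) in simp)
  then show "y \<in> h ` C" using assms(1) h by (simp add: stable_value_def)
qed

text \<open>A competitor for \<open>y'\<close> shifted by \<open>y - y'\<close> is a competitor for
  \<open>y\<close>, at a cost of at most \<open>a\<close> in its distance to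
  \<open>f\<close>.\<close>

lemma stable_value_translate:
  assumes "stable_value X f C y d" "\<And>j. \<bar>y $ j - y' $ j\<bar> \<le> a" "b \<le> d - a"
  shows "stable_value X f C y' b"
  unfolding stable_value_def
proof (intro allI impI)
  fix h assume h: "continuous_map X euclidean h \<and> near C b f h"
  have "continuous_map X euclidean (\<lambda>x. h x + (y - y'))"
    using h by (simp add: continuous_map_add)
  moreover have "near C d f (\<lambda>x. h x + (y - y'))"
    unfolding near_def
  proof (intro ballI allI)
    fix x j assume "x \<in> C"
    then have "\<bar>f x $ j - h x $ j\<bar> \<le> b" using h by (auto simp: near_def)
    then show "\<bar>f x $ j - (h x + (y - y')) $ j\<bar> \<le> d" using assms(2)[of j] assms(3) by simp
  qed
  ultimately have "y \<in> (\<lambda>x. h x + (y - y')) ` C"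
    by (rule stable_valueD[OF assms(1)])
  then obtain x where x: "x \<in> C" "y = h x + (y - y')" by blast
  from x(2) have "y' = h x" by (simp add: algebra_simps)
  with x(1) show "y' \<in> h ` C" by blast
qed

text \<open>Clamping each coordinate of \<open>h - f\<close> to \<open>[-d, d]\<close> changes
  nothing on \<open>C\<close> and makes the map close to \<open>f\<close> everywhere.\<close>

lemma near_extension:
  fixes f h :: "'a \<Rightarrow> real^'n"
  assumes "continuous_map X euclidean f" "continuous_map X euclidean h" "near C d f h" "0 \<le> d"
  obtains h' where "continuous_map X euclidean h'" "\<And>A. near A d f h'" "\<And>x. x \<in> C \<Longrightarrow> h' x = h x"
proof
  let ?c = "\<lambda>t::real. max (-d) (min d t)"
  let ?h = "\<lambda>x. f x + (\<chi> j. ?c ((h x - f x) $ j))"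
  have "continuous_on UNIV ?c" by (intro continuous_intros)
  then have "continuous_on UNIV (\<lambda>p::real^'n. \<chi> j. ?c (p $ j))" by (rule continuous_on_vec_map)
  moreover have "continuous_map X euclidean (\<lambda>x. h x - f x)"
    using assms by (simp add: continuous_map_diff)
  ultimately have "continuous_map X euclidean (\<lambda>x. \<chi> j. ?c ((h x - f x) $ j))"
    by (rule continuous_map_compose_UNIV[rotated])
  then show "continuous_map X euclidean ?h" using assms by (simp add: continuous_map_add)
  show "near A d f ?h" for A using assms(4) by (auto simp: near_def)
  show "?h x = h x" if "x \<in> C" for x
  proof -
    have "?c ((h x - f x) $ j) = h x $ j - f x $ j" for j
      using nearD[OF assms(3) that, of j] assms(4) by (auto simp: max_def min_def)
    then show ?thesis by (simp add: vec_eq_iff)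
  qed
qed

text \<open>A map within \<open>d\<close> of \<open>f\<close> takes the value \<open>y\<close> only
  where \<open>f\<close> is within \<open>d\<close> of \<open>y\<close>. A competitor on the smaller
  set is first extended to one on \<open>C\<close>.\<close>

lemma stable_value_localize:
  fixes f :: "'a \<Rightarrow> real^'n"
  assumes "stable_value X f C y d" "continuous_map X euclidean f" "0 \<le> d"
    and B: "\<And>p. (\<And>j. \<bar>p $ j - y $ j\<bar> \<le> d) \<Longrightarrow> p \<in> B"
  shows "stable_value X f {x \<in> C. f x \<in> B} y d"
  unfolding stable_value_def
proof (intro allI impI)
  fix h assume h: "continuous_map X euclidean h \<and> near {x \<in> C. f x \<in> B} d f h"
  then obtain h' where h': "continuous_map X euclidean h'" "\<And>A. near A d f h'"
      "\<And>x. x \<in> {x \<in> C. f x \<in> B} \<Longrightarrow> h' x = h x"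
    using near_extension[OF assms(2) _ _ assms(3), of h "{x \<in> C. f x \<in> B}"] by blast
  then obtain x where x: "x \<in> C" "h' x = y"
    using stable_valueD[OF assms(1) h'(1)] by auto
  then have "f x \<in> B"
    using B[of "f x"] nearD[OF h'(2), of x C] by simp
  then show "y \<in> h ` {x \<in> C. f x \<in> B}" using x h'(3) by force
qed

text \<open>Undoing the dilation about \<open>z\<close> turns a competitor for \<open>g'\<close>
  into one for \<open>g\<close> and divides distances by \<open>c\<close>.\<close>

lemma stable_value_affine:
  fixes g g' :: "'a \<Rightarrow> real^'n"
  assumes "stable_value X g C p d" "0 < c"
    and g': "\<And>x. x \<in> C \<Longrightarrow> g' x = z + c *\<^sub>R (g x - z)"
  shows "stable_value X g' C (z + c *\<^sub>R (p - z)) (c * d)"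
  unfolding stable_value_def
proof (intro allI impI)
  fix h assume h: "continuous_map X euclidean h \<and> near C (c * d) g' h"
  let ?h = "\<lambda>x. z + (1/c) *\<^sub>R (h x - z)"
  have "continuous_map X euclidean ?h"
    using h by (simp add: continuous_map_add continuous_map_diff continuous_map_scaleR)
  moreover have "near C d g ?h"
    unfolding near_def
  proof (intro ballI allI)
    fix x j assume x: "x \<in> C"
    have "g x $ j - ?h x $ j = (1/c) * (g' x $ j - h x $ j)"
      using assms(2) by (simp add: g'[OF x] field_simps)
    then have "\<bar>g x $ j - ?h x $ j\<bar> = (1/c) * \<bar>g' x $ j - h x $ j\<bar>"
      using assms(2) by (simp add: abs_mult)
    moreover have "\<bar>g' x $ j - h x $ j\<bar> \<le> c * d" using h x by (auto simp: near_def)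
    ultimately show "\<bar>g x $ j - ?h x $ j\<bar> \<le> d"
      using assms(2) by (simp add: divide_simps mult.commute)
  qed
  ultimately have "p \<in> ?h ` C"
    by (rule stable_valueD[OF assms(1)])
  then obtain x where x: "x \<in> C" "p = ?h x" by blast
  then have "z + c *\<^sub>R (p - z) = h x" using assms(2) by simp
  then show "z + c *\<^sub>R (p - z) \<in> h ` C" using x by auto
qed

text \<open>The stretching step: stability of the single point \<open>z\<close> spreads to a cube of
  half-width \<open>c * \<tau> - \<eta>\<close>. Localizing to the window comes before the dilation
  because only there is \<open>g'\<close> known to be affine in \<open>g\<close>.\<close>

lemma stable_value_window:
  fixes g g' :: "'a \<Rightarrow> real^'n"
  assumes st: "stable_value X g C z d" and g: "continuous_map X euclidean g"
    and "0 < \<tau>" "\<tau> \<le> d" "0 < c" "0 \<le> \<eta>"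
    and g': "\<And>x. x \<in> C \<Longrightarrow> (\<And>j. \<bar>g x $ j - z $ j\<bar> \<le> \<tau>) \<Longrightarrow> g' x = z + c *\<^sub>R (g x - z)"
    and y: "\<And>j. \<bar>y $ j - z $ j\<bar> \<le> c * \<tau> - \<eta>"
  shows "stable_value X g' {x \<in> C. \<forall>j. \<bar>g x $ j - z $ j\<bar> \<le> \<tau>} y \<eta>"
proof -
  \<comment> \<open>The point that the dilation carries to \<open>y\<close>; it keeps a margin
    \<open>\<eta> / c\<close> inside the window.\<close>
  define p where "p = z + (1/c) *\<^sub>R (y - z)"
  have pz: "\<bar>p $ j - z $ j\<bar> \<le> \<tau> - \<eta> / c" for j
  proof -
    have "\<bar>p $ j - z $ j\<bar> = \<bar>y $ j - z $ j\<bar> / c" using assms(5) by (simp add: p_def)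
    also have "\<dots> \<le> (c * \<tau> - \<eta>) / c" using y[of j] assms(5) by (simp add: divide_right_mono)
    finally show ?thesis using assms(5) by (simp add: diff_divide_distrib)
  qed
  \<comment> \<open>The radius left is \<open>d - (\<tau> - \<eta> / c)\<close>, at least
    \<open>\<eta> / c\<close> since \<open>\<tau> \<le> d\<close>.\<close>
  have "stable_value X g C p (\<eta> / c)"
    using pz assms(4) by (intro stable_value_translate[OF st, of _ "\<tau> - \<eta> / c"]) (auto simp: abs_minus_commute)
  then have "stable_value X g {x \<in> C. g x \<in> {q. \<forall>j. \<bar>q $ j - z $ j\<bar> \<le> \<tau>}} p (\<eta> / c)"
  proof (rule stable_value_localize[OF _ g])
    fix q assume q: "\<And>j. \<bar>q $ j - p $ j\<bar> \<le> \<eta> / c"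
    have "\<bar>q $ j - z $ j\<bar> \<le> \<tau>" for j using q[of j] pz[of j] by linarith
    then show "q \<in> {q. \<forall>j. \<bar>q $ j - z $ j\<bar> \<le> \<tau>}" by simp
  qed (use assms in auto)
  then have "stable_value X g' {x \<in> C. g x \<in> {q. \<forall>j. \<bar>q $ j - z $ j\<bar> \<le> \<tau>}}
      (z + c *\<^sub>R (p - z)) (c * (\<eta> / c))"
    by (rule stable_value_affine) (use assms(5) g' in auto)
  moreover have "z + c *\<^sub>R (p - z) = y" using assms(5) by (simp add: p_def)
  ultimately show ?thesis using assms(5) by simp
qed

section \<open>Making finitely many values stable or avoided\<close>

lemma avoids_value_robust:
  fixes h :: "'a \<Rightarrow> real^'n"
  assumes "compact_space X" "closedin X C" "continuous_map X euclidean h" "z \<notin> h ` C"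
  obtains \<eta> where "\<eta> > 0" "\<And>x. x \<in> C \<Longrightarrow> \<exists>j. \<bar>h x $ j - z $ j\<bar> > \<eta>"
proof -
  have "compactin X C" using assms closedin_compact_space by blast
  then have "compact (h ` C)" using image_compactin[OF _ assms(3)] by simp
  then obtain d where d: "d > 0" "\<And>w. w \<in> h ` C \<Longrightarrow> d \<le> dist z w"
    using separate_point_closed[OF compact_imp_closed assms(4)] by auto
  \<comment> \<open>If all coordinates were within \<open>\<eta>\<close> of those of
    \<open>z\<close>, the sum of the differences, hence the norm, would be at most
    \<open>d / 2\<close>.\<close>
  define \<eta> where "\<eta> = d / (2 * real CARD('n))"
  have "\<exists>j. \<bar>h x $ j - z $ j\<bar> > \<eta>" if "x \<in> C" for x
  proof (rule ccontr)
    assume "\<not> ?thesis"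
    then have le: "\<bar>(h x - z) $ j\<bar> \<le> \<eta>" for j by (simp add: not_less)
    have "norm (h x - z) \<le> (\<Sum>j\<in>UNIV. \<bar>(h x - z) $ j\<bar>)" by (rule norm_le_l1_cart)
    also have "\<dots> \<le> (\<Sum>j\<in>(UNIV::'n set). \<eta>)" by (rule sum_mono) (rule le)
    also have "\<dots> = d / 2" by (simp add: \<eta>_def)
    finally show False using d(2)[of "h x"] that d(1) by (simp add: dist_norm norm_minus_commute)
  qed
  moreover have "\<eta> > 0" using d(1) by (simp add: \<eta>_def)
  ultimately show ?thesis using that by blast
qed

text \<open>Induction over the pairs. If the new value is stable at no radius, arbitrarily close
  maps miss it on its set; compactness turns missing into a positive gap, and a small enough
  perturbation preserves what was achieved for the earlier pairs.\<close>

lemma stable_or_avoided_perturbation: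
  fixes f :: "'a \<Rightarrow> real^'n"
  assumes X: "compact_space X" and "finite F" and F: "\<forall>(C, z)\<in>F. closedin X C"
    and f: "continuous_map X euclidean f" and "e > 0"
  obtains g d where "continuous_map X euclidean g" "\<And>A. near A e f g" "d > 0"
    "\<And>C z. (C, z) \<in> F \<Longrightarrow>
       stable_value X g C z d \<or> (\<forall>x\<in>C. \<exists>j. \<bar>g x $ j - z $ j\<bar> > d)"
proof -
  have "\<exists>g d. continuous_map X euclidean g \<and> (\<forall>A. near A e f g) \<and> d > 0 \<and> (\<forall>(C, z)\<in>F.
      stable_value X g C z d \<or> (\<forall>x\<in>C. \<exists>j. \<bar>g x $ j - z $ j\<bar> > d))"
    using assms(2) F \<open>e > 0\<close>
  proof (induction F arbitrary: e rule: finite_induct)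
    case empty
    then have "\<forall>A. near A e f f" by (auto simp: near_def)
    then show ?case using f by (intro exI[of _ f] exI[of _ 1]) auto
  next
    case (insert P F)
    obtain C0 z0 where P: "P = (C0, z0)" by force
    have C0: "closedin X C0" using insert.prems(1) P by simp
    obtain g d where g: "continuous_map X euclidean g" "\<And>A. near A (e/2) f g" "d > 0"
      and gF: "\<And>C z. (C, z) \<in> F \<Longrightarrow>
        stable_value X g C z d \<or> (\<forall>x\<in>C. \<exists>j. \<bar>g x $ j - z $ j\<bar> > d)"
    proof -
      have "\<exists>g d. continuous_map X euclidean g \<and> (\<forall>A. near A (e/2) f g) \<and> d > 0 \<and> (\<forall>(C, z)\<in>F.
          stable_value X g C z d \<or> (\<forall>x\<in>C. \<exists>j. \<bar>g x $ j - z $ j\<bar> > d))"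
        by (rule insert.IH) (use insert.prems in auto)
      then show ?thesis using that by blast
    qed
    show ?case
    proof (cases "\<exists>d'>0. stable_value X g C0 z0 d'")
      case True
      then obtain d' where d': "d' > 0" "stable_value X g C0 z0 d'" by blast
      have "stable_value X g C z (min d d') \<or> (\<forall>x\<in>C. \<exists>j. \<bar>g x $ j - z $ j\<bar> > min d d')"
        if "(C, z) \<in> insert P F" for C z
      proof (cases "(C, z) = P")
        case True
        then show ?thesis using stable_value_mono[OF d'(2) order_refl, of "min d d'"] P by auto
      next
        case False
        then have "(C, z) \<in> F" using that by simp
        from gF[OF this] show ?thesis
          using stable_value_mono[OF _ order_refl, of X g C z d "min d d'"]
          by (auto simp: min_less_iff_disj)
      qed
      moreover have "near A e f g" for A using near_mono[OF g(2)[of A] order_refl, of e] insert.prems(2) by simp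
      ultimately show ?thesis using g d' by (intro exI[of _ g] exI[of _ "min d d'"]) auto
    next
      case False
      \<comment> \<open>\<open>e/2\<close> is the tolerance left by the induction hypothesis;
        \<open>d/2\<close> lets earlier stability and avoidance survive with half their
        radius.\<close>
      define b where "b = min (e/2) (d/2)"
      have b: "b > 0" "b \<le> e/2" "b \<le> d/2" using g(3) insert.prems by (auto simp: b_def)
      obtain h0 where h0: "continuous_map X euclidean h0" "near C0 b g h0" "z0 \<notin> h0 ` C0"
        using False b(1) by (auto simp: stable_value_def)
      \<comment> \<open>\<open>h0\<close> is controlled only on \<open>C0\<close>; the extension is
        also controlled on the sets of the earlier pairs.\<close>
      obtain h where h: "continuous_map X euclidean h" "\<And>A. near A b g h" "\<And>x. x \<in> C0 \<Longrightarrow> h x = h0 x"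
        using near_extension[OF g(1) h0(1,2) less_imp_le[OF b(1)]] by blast
      have "z0 \<notin> h ` C0" using h0(3) h(3) by auto
      then obtain \<eta> where \<eta>: "\<eta> > 0" "\<And>x. x \<in> C0 \<Longrightarrow> \<exists>j. \<bar>h x $ j - z0 $ j\<bar> > \<eta>"
        using avoids_value_robust[OF X C0 h(1)] by blast
      define d' where "d' = min \<eta> (d/2)"
      have "stable_value X h C z d' \<or> (\<forall>x\<in>C. \<exists>j. \<bar>h x $ j - z $ j\<bar> > d')"
        if CF: "(C, z) \<in> insert P F" for C z
      proof (cases "(C, z) = P")
        case True
        have "\<exists>j. \<bar>h x $ j - z0 $ j\<bar> > d'" if "x \<in> C0" for x
          using \<eta>(2)[OF that] by (auto simp: d'_def min_less_iff_disj)
        then show ?thesis using True P by simp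
      next
        case False
        then have "(C, z) \<in> F" using CF by simp
        then consider "stable_value X g C z d" | "\<forall>x\<in>C. \<exists>j. \<bar>g x $ j - z $ j\<bar> > d" using gF by blast
        then show ?thesis
        proof cases
          case 1
          show ?thesis
            using stable_value_perturb[OF 1 h(2), of d'] b by (auto simp: d'_def)
        next
          case 2
          have "\<exists>j. \<bar>h x $ j - z $ j\<bar> > d'" if xC: "x \<in> C" for x
          proof -
            obtain j where "\<bar>g x $ j - z $ j\<bar> > d" using 2 xC by blast
            moreover have "\<bar>g x $ j - h x $ j\<bar> \<le> b" using nearD[OF h(2) xC] .
            ultimately have "\<bar>h x $ j - z $ j\<bar> > d/2" using b by linarith
            moreover have "d' \<le> d/2" by (simp add: d'_def)
            ultimately have "\<bar>h x $ j - z $ j\<bar> > d'" by linarith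
            then show ?thesis by blast
          qed
          then show ?thesis by blast
        qed
      qed
      moreover have "near A e f h" for A
        using near_mono[OF near_trans[OF g(2) h(2)], of A A e] b by simp
      moreover have "d' > 0" using \<eta> g(3) by (simp add: d'_def)
      ultimately show ?thesis using h(1) by (intro exI[of _ h] exI[of _ d']) auto
    qed
  qed
  then show ?thesis using that by blast
qed

section \<open>Zigzag maps and grids\<close>

lemma round_grid:
  fixes e t t0 :: real
  assumes "e > 0"
  shows "\<bar>t - (t0 + 2 * e * of_int (round ((t - t0) / (2 * e))))\<bar> \<le> e"
proof -
  define s where "s = (t - t0) / (2 * e)"
  have t: "t = t0 + 2 * e * s" using assms by (simp add: s_def)
  have "t - (t0 + 2 * e * of_int (round s)) = - (2 * e) * (of_int (round s) - s)"
    unfolding t by (simp add: algebra_simps)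
  then have "\<bar>t - (t0 + 2 * e * of_int (round s))\<bar> = 2 * e * \<bar>of_int (round s) - s\<bar>"
    using assms by (simp add: abs_mult)
  also have "\<dots> \<le> 2 * e * (1/2)"
    using assms by (intro mult_left_mono of_int_round_abs_le) auto
  finally show ?thesis by (simp add: s_def)
qed

lemma grid_separated:
  fixes e :: real
  assumes "e > 0" "k \<noteq> k'"
  shows "\<bar>(t0 + 2 * e * of_int k) - (t0 + 2 * e * of_int k')\<bar> \<ge> 2 * e"
proof -
  have "1 \<le> \<bar>k - k'\<bar>" using assms(2) by linarith
  then have "1 \<le> \<bar>of_int k - of_int k' :: real\<bar>" by linarith
  then have "2 * e * 1 \<le> 2 * e * \<bar>of_int k - of_int k' :: real\<bar>"
    using assms(1) by (intro mult_left_mono) auto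
  also have "\<dots> = \<bar>2 * e * (of_int k - of_int k')\<bar>" using assms(1) by (simp add: abs_mult)
  finally show ?thesis by (simp add: right_diff_distrib)
qed

text \<open>
  The cells have centres \<open>t0 + 2ek\<close> and half-width \<open>e\<close>; \<open>\<sigma>\<close> is the overshoot beyond the cell, so that \<open>\<psi>\<close>
  is a continuous staircase for \<open>\<sigma> = 0\<close>.
\<close>

lemma exists_zigzag:
  fixes e \<tau> \<sigma> t0 :: real
  assumes "0 < \<tau>" "\<tau> < e" "0 \<le> \<sigma>"
  obtains \<psi> :: "real \<Rightarrow> real" where "continuous_on UNIV \<psi>"
    "\<And>t k::int. \<bar>t - (t0 + 2 * e * of_int k)\<bar> \<le> \<tau> \<Longrightarrow>
       \<psi> t = (t0 + 2 * e * of_int k) + ((e + \<sigma>) / \<tau>) * (t - (t0 + 2 * e * of_int k))"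
    "\<And>t k::int. \<bar>\<psi> t - (t0 + 2 * e * of_int k)\<bar> < e - \<sigma> \<Longrightarrow> \<bar>t - (t0 + 2 * e * of_int k)\<bar> \<le> \<tau>"
    "\<And>t. \<bar>\<psi> t - t\<bar> \<le> 2 * e + \<sigma>"
proof -
  have e: "e > 0" using assms by simp
  define z where "z k = t0 + 2 * e * of_int k" for k :: int
  \<comment> \<open>\<open>\<zeta>\<close> is the profile of one cell: it climbs linearly to
    \<open>e + \<sigma>\<close> at \<open>\<tau>\<close>, then returns linearly to \<open>e\<close>
    at the wall, so that neighbouring cells fit together.\<close>
  define c where "c s = max (-\<tau>) (min \<tau> s)" for s
  define \<zeta> where "\<zeta> s = ((e + \<sigma>) / \<tau>) * c s - (\<sigma> / (e - \<tau>)) * (s - c s)" for s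
  define \<psi> where "\<psi> t = z (round ((t - t0) / (2 * e))) + \<zeta> (t - z (round ((t - t0) / (2 * e))))" for t
  have \<zeta>_in: "\<zeta> s = ((e + \<sigma>) / \<tau>) * s" if "\<bar>s\<bar> \<le> \<tau>" for s
  proof -
    have "c s = s" using that by (auto simp: c_def)
    then show ?thesis by (simp add: \<zeta>_def)
  qed
  have \<zeta>_pos: "\<zeta> s = e + \<sigma> * ((e - s) / (e - \<tau>))" if "\<tau> \<le> s" for s
  proof -
    have cs: "c s = \<tau>" using that assms by (auto simp: c_def)
    have "\<zeta> s = (e + \<sigma>) - \<sigma> * ((s - \<tau>) / (e - \<tau>))" using assms by (simp add: \<zeta>_def cs)
    also have "(s - \<tau>) / (e - \<tau>) = 1 - (e - s) / (e - \<tau>)"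
      using assms by (simp add: field_simps)
    finally show ?thesis by (simp add: right_diff_distrib)
  qed
  have \<zeta>_neg: "\<zeta> (- s) = - \<zeta> s" for s
  proof -
    have cn: "c (- s) = - c s" using assms by (auto simp: c_def max_def min_def)
    have alg: "a * (- x) - b * (- s - (- x)) = - (a * x - b * (s - x))" for a b x :: real
      by (simp add: algebra_simps)
    show ?thesis unfolding \<zeta>_def cn by (rule alg)
  qed
  have frac: "0 \<le> \<sigma> * ((e - s) / (e - \<tau>))" "\<sigma> * ((e - s) / (e - \<tau>)) \<le> \<sigma>" if "\<tau> \<le> s" "s \<le> e" for s
  proof -
    have "0 \<le> (e - s) / (e - \<tau>)" "(e - s) / (e - \<tau>) \<le> 1" using that assms by auto
    then show "0 \<le> \<sigma> * ((e - s) / (e - \<tau>))" "\<sigma> * ((e - s) / (e - \<tau>)) \<le> \<sigma>"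
      using mult_nonneg_nonneg[OF assms(3)] mult_left_le[OF _ assms(3)] by blast+
  qed
  have \<zeta>_out: "e \<le> \<bar>\<zeta> s\<bar> \<and> \<bar>\<zeta> s\<bar> \<le> e + \<sigma>" if "\<tau> \<le> \<bar>s\<bar>" "\<bar>s\<bar> \<le> e" for s
  proof (cases "s \<ge> 0")
    case True
    then show ?thesis using \<zeta>_pos[of s] frac[of s] that e by simp
  next
    case False
    then show ?thesis using \<zeta>_pos[of "-s"] frac[of "-s"] that e \<zeta>_neg[of s] by simp
  qed
  have \<zeta>_le: "\<bar>\<zeta> s\<bar> \<le> e + \<sigma>" if "\<bar>s\<bar> \<le> e" for s
  proof (cases "\<tau> \<le> \<bar>s\<bar>")
    case False
    then have "\<bar>\<zeta> s\<bar> = ((e + \<sigma>) / \<tau>) * \<bar>s\<bar>" using \<zeta>_in[of s] assms by (simp add: abs_mult)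
    also have "\<dots> \<le> ((e + \<sigma>) / \<tau>) * \<tau>" using False assms by (intro mult_left_mono) auto
    finally show ?thesis using assms by simp
  qed (use \<zeta>_out that in blast)
  have \<zeta>_e: "\<zeta> e = e" using \<zeta>_pos[of e] assms by simp
  have near_z: "\<exists>k. \<bar>t - z k\<bar> \<le> e" for t
    unfolding z_def using round_grid[OF e] by blast
  have \<zeta>_end: "z k + \<zeta> (t - z k) = t" if "\<bar>t - z k\<bar> = e" for t k
  proof (cases "t - z k = e")
    case False
    then have "t - z k = - e" using that by linarith
    then show ?thesis using \<zeta>_neg[of e] \<zeta>_e by simp
  qed (use \<zeta>_e in simp)
  \<comment> \<open>A point within \<open>e\<close> of two centres lies on their common wall, where
    both formulas return the point itself.\<close>
  have uniq: "z k + \<zeta> (t - z k) = z k' + \<zeta> (t - z k')"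
    if k: "\<bar>t - z k\<bar> \<le> e" and k': "\<bar>t - z k'\<bar> \<le> e" for t k k'
  proof (cases "k = k'")
    case False
    then have "2 * e \<le> \<bar>z k - z k'\<bar>" using grid_separated[OF e] z_def by simp
    then have "\<bar>t - z k\<bar> = e" "\<bar>t - z k'\<bar> = e" using k k' by linarith+
    then show ?thesis using \<zeta>_end by simp
  qed simp
  have \<psi>: "\<psi> t = z k + \<zeta> (t - z k)" if "\<bar>t - z k\<bar> \<le> e" for t k
  proof -
    let ?r = "round ((t - t0) / (2 * e))"
    have "\<bar>t - z ?r\<bar> \<le> e" unfolding z_def by (rule round_grid[OF e])
    then show ?thesis unfolding \<psi>_def by (rule uniq) (rule that)
  qed
  have cz: "continuous_on S (\<lambda>t. z k + \<zeta> (t - z k))" for S k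
    unfolding \<zeta>_def c_def by (intro continuous_intros)
  have cont1: "continuous_on {z k - e..z k + e} \<psi>" for k
    by (rule continuous_on_eq[OF cz[of _ k]]) (use \<psi>[of _ k] in \<open>auto simp: abs_le_iff\<close>)
  have "isCont \<psi> t" for t
  proof -
    obtain k where k: "\<bar>t - z k\<bar> \<le> e" using near_z by blast
    \<comment> \<open>Three adjacent closed cells contain a neighbourhood of
      \<open>t\<close>.\<close>
    have "continuous_on ({z (k - 1) - e..z (k - 1) + e} \<union> ({z k - e..z k + e} \<union> {z (k + 1) - e..z (k + 1) + e})) \<psi>"
      by (intro continuous_on_closed_Un cont1) auto
    then have "continuous_on {z k - 3 * e..z k + 3 * e} \<psi>"
    proof (rule continuous_on_subset)
      show "{z k - 3 * e..z k + 3 * e} \<subseteq>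
          {z (k - 1) - e..z (k - 1) + e} \<union> ({z k - e..z k + e} \<union> {z (k + 1) - e..z (k + 1) + e})"
        by (auto simp: z_def algebra_simps)
    qed
    then show "isCont \<psi> t" by (rule continuous_on_interior) (use k e in auto)
  qed
  then have 1: "continuous_on UNIV \<psi>" by (simp add: continuous_at_imp_continuous_on)
  have 2: "\<psi> t = z k + ((e + \<sigma>) / \<tau>) * (t - z k)" if "\<bar>t - z k\<bar> \<le> \<tau>" for t k
    using \<psi>[of t k] \<zeta>_in[OF that] that assms by simp
  \<comment> \<open>In its own cell but outside the window, \<open>\<psi>\<close> stays at least
    \<open>e\<close> from the centre; values from another cell lie within
    \<open>e + \<sigma>\<close> of a centre at least \<open>2 * e\<close> away. Hence the threshold
    \<open>e - \<sigma>\<close>.\<close>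
  have 3: "\<bar>t - z k\<bar> \<le> \<tau>" if "\<bar>\<psi> t - z k\<bar> < e - \<sigma>" for t k
  proof (rule ccontr)
    assume n: "\<not> \<bar>t - z k\<bar> \<le> \<tau>"
    show False
    proof (cases "\<bar>t - z k\<bar> \<le> e")
      case True
      then show False using \<psi>[OF True] \<zeta>_out[of "t - z k"] n that assms by simp
    next
      case False
      obtain k' where k': "\<bar>t - z k'\<bar> \<le> e" using near_z by blast
      then have "k \<noteq> k'" using False by blast
      then have "2 * e \<le> \<bar>z k - z k'\<bar>" using grid_separated[OF e] z_def by simp
      moreover have "\<bar>\<psi> t - z k'\<bar> \<le> e + \<sigma>" using \<psi>[OF k'] \<zeta>_le[OF k'] by simp
      ultimately show False using that by linarith
    qed
  qed
  have 4: "\<bar>\<psi> t - t\<bar> \<le> 2 * e + \<sigma>" for t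
  proof -
    obtain k where k: "\<bar>t - z k\<bar> \<le> e" using near_z by blast
    have "\<bar>\<psi> t - z k\<bar> \<le> e + \<sigma>" using \<psi>[OF k] \<zeta>_le[OF k] by simp
    then show ?thesis using k by linarith
  qed
  show ?thesis using that[of \<psi>] 1 2 3 4 unfolding z_def by blast
qed

lemma finite_grid:
  fixes e t0 M :: real
  assumes "e > 0"
  obtains G :: "(real^'n) set" where "finite G"
    "\<And>y. (\<And>j. \<bar>y $ j\<bar> \<le> M) \<Longrightarrow>
       \<exists>\<kappa>::'n \<Rightarrow> int. (\<chi> j. t0 + 2 * e * of_int (\<kappa> j)) \<in> G \<and>
         (\<forall>j. \<bar>y $ j - (t0 + 2 * e * of_int (\<kappa> j))\<bar> \<le> e)"
proof
  \<comment> \<open>If \<open>y $ j\<close> is within \<open>e\<close> of the grid value of index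
    \<open>\<kappa> j\<close>, then \<open>2 * e * \<bar>\<kappa> j\<bar>\<close> is at most
    \<open>M + e + \<bar>t0\<bar>\<close>.\<close>
  define N where "N = \<lceil>(M + e + \<bar>t0\<bar>) / (2 * e)\<rceil>"
  let ?G = "(\<lambda>\<kappa>. \<chi> j. t0 + 2 * e * of_int (\<kappa> j)) ` (UNIV \<rightarrow>\<^sub>E {-N..N}) :: (real^'n) set"
  show "finite ?G" by (intro finite_imageI finite_PiE) auto
  fix y :: "real^'n" assume y: "\<And>j. \<bar>y $ j\<bar> \<le> M"
  have "\<forall>j. \<exists>k::int. \<bar>y $ j - (t0 + 2 * e * of_int k)\<bar> \<le> e"
    using round_grid[OF assms] by blast
  then obtain \<kappa> where \<kappa>: "\<And>j. \<bar>y $ j - (t0 + 2 * e * of_int (\<kappa> j))\<bar> \<le> e" by metis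
  have "\<kappa> j \<in> {-N..N}" for j
  proof -
    have "\<bar>2 * e * of_int (\<kappa> j)\<bar> \<le> M + e + \<bar>t0\<bar>" using \<kappa>[of j] y[of j] by linarith
    moreover have "\<bar>2 * e * of_int (\<kappa> j)\<bar> = 2 * e * \<bar>of_int (\<kappa> j)\<bar>" using assms by (simp add: abs_mult)
    ultimately have "\<bar>of_int (\<kappa> j)\<bar> \<le> (M + e + \<bar>t0\<bar>) / (2 * e)"
      using assms by (simp add: field_simps)
    also have "\<dots> \<le> of_int N" unfolding N_def by (rule le_of_int_ceiling)
    finally have "\<bar>\<kappa> j\<bar> \<le> N" by linarith
    then show ?thesis by auto
  qed
  then have "\<kappa> \<in> UNIV \<rightarrow>\<^sub>E {-N..N}" by auto
  then show "\<exists>\<kappa>::'n \<Rightarrow> int. (\<chi> j. t0 + 2 * e * of_int (\<kappa> j)) \<in> ?G \<and>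
         (\<forall>j. \<bar>y $ j - (t0 + 2 * e * of_int (\<kappa> j))\<bar> \<le> e)"
    using \<kappa> by blast
qed

lemma continuous_map_bounded:
  fixes f :: "'a \<Rightarrow> real^'n"
  assumes "compact_space X" "continuous_map X euclidean f"
  obtains M where "\<And>x j. x \<in> topspace X \<Longrightarrow> \<bar>f x $ j\<bar> \<le> M"
proof -
  have "compact (f ` topspace X)"
    using image_compactin[OF _ assms(2)] assms(1) by (simp add: compact_space_def)
  then obtain M where "\<And>x. x \<in> topspace X \<Longrightarrow> norm (f x) \<le> M"
    using compact_imp_bounded bounded_iff by (metis imageI)
  then show ?thesis using that component_le_norm_cart order_trans by metis
qed

lemma closedin_window:
  fixes f :: "'a \<Rightarrow> real^'n"
  assumes "closedin X C" "continuous_map X euclidean f"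
  shows "closedin X {x \<in> C. \<forall>j. \<bar>f x $ j - z $ j\<bar> \<le> \<tau>}"
proof -
  have "closed {p. \<forall>j. \<bar>p $ j - z $ j\<bar> \<le> \<tau>}"
    by (intro closed_Collect_all closed_Collect_le continuous_intros)
  then have "closedin X {x \<in> topspace X. f x \<in> {p. \<forall>j. \<bar>p $ j - z $ j\<bar> \<le> \<tau>}}"
    by (intro closedin_continuous_map_preimage[OF assms(2)]) simp
  then have "closedin X (C \<inter> {x \<in> topspace X. f x \<in> {p. \<forall>j. \<bar>p $ j - z $ j\<bar> \<le> \<tau>}})"
    using assms(1) by blast
  moreover have "C \<inter> {x \<in> topspace X. f x \<in> {p. \<forall>j. \<bar>p $ j - z $ j\<bar> \<le> \<tau>}} =
      {x \<in> C. \<forall>j. \<bar>f x $ j - z $ j\<bar> \<le> \<tau>}"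
    using closedin_subset[OF assms(1)] by auto
  ultimately show ?thesis by simp
qed

section \<open>Perturbations\<close>

lemma near_vec_map:
  assumes "\<And>t. \<bar>\<psi> t - t\<bar> \<le> a"
  shows "near A a f (\<lambda>x. \<chi> j. \<psi> (f x $ j))"
  using assms by (simp add: near_def abs_minus_commute)

text \<open>The ball about \<open>y\<close> contains the centre \<open>z\<close> of the cell of
  \<open>y\<close>. The zigzag comes near \<open>z\<close> only from the window around
  \<open>z\<close>, so \<open>g0\<close> does not avoid \<open>z\<close>; hence \<open>z\<close> is
  stable, and stretching makes \<open>y\<close> stable.\<close>

lemma interior_value_perturbation:
  fixes f :: "'a \<Rightarrow> real^'n"
  assumes X: "compact_space X" and f: "continuous_map X euclidean f" and "\<epsilon> > 0" "r > 0"
  obtains g d where "continuous_map X euclidean g" "near (topspace X) \<epsilon> f g" "d > 0"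
    "\<And>h y. continuous_map X euclidean h \<Longrightarrow> near (topspace X) d g h \<Longrightarrow>
       ball y r \<subseteq> h ` topspace X \<Longrightarrow> \<exists>b>0. stable_value X h (topspace X) y b"
proof -
  \<comment> \<open>The grid perturbation uses \<open>\<epsilon>/2\<close> and the zigzag
    \<open>2 * e + e/2\<close>; the bound by \<open>r\<close> puts the cell centre into
    \<open>ball y r\<close>.\<close>
  define e where "e = min (\<epsilon> / 6) (r / (2 * real CARD('n)))"
  have e: "e > 0" "6 * e \<le> \<epsilon>" using assms by (auto simp: e_def)
  have er: "real CARD('n) * e < r"
  proof -
    have "real CARD('n) * e \<le> real CARD('n) * (r / (2 * real CARD('n)))"
      by (intro mult_left_mono) (auto simp: e_def)
    also have "\<dots> < r" using assms by simp
    finally show ?thesis .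
  qed
  obtain M where M: "\<And>x j. x \<in> topspace X \<Longrightarrow> \<bar>f x $ j\<bar> \<le> M"
    using continuous_map_bounded[OF X f] by blast
  obtain G :: "(real^'n) set" where G: "finite G"
    "\<And>y. (\<And>j. \<bar>y $ j\<bar> \<le> M + \<epsilon> + 2 * e) \<Longrightarrow>
       \<exists>\<kappa>::'n \<Rightarrow> int. (\<chi> j. 0 + 2 * e * of_int (\<kappa> j)) \<in> G \<and>
         (\<forall>j. \<bar>y $ j - (0 + 2 * e * of_int (\<kappa> j))\<bar> \<le> e)"
    using finite_grid[OF e(1), of "M + \<epsilon> + 2 * e" 0] by blast
  have cl: "\<forall>(C, z)\<in>{topspace X} \<times> G. closedin X C" by simp
  have fin: "finite ({topspace X} \<times> G)" using G(1) by simp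
  obtain g0 d0 where g0: "continuous_map X euclidean g0" "\<And>A. near A (\<epsilon>/2) f g0" "d0 > 0"
    and dich: "\<And>C z. (C, z) \<in> {topspace X} \<times> G \<Longrightarrow>
       stable_value X g0 C z d0 \<or> (\<forall>x\<in>C. \<exists>j. \<bar>g0 x $ j - z $ j\<bar> > d0)"
    by (rule stable_or_avoided_perturbation[OF X fin cl f half_gt_zero[OF \<open>\<epsilon> > 0\<close>]]) blast
  \<comment> \<open>The window lies within the radius \<open>d0\<close>, both to contradict
    avoidance and to permit stretching.\<close>
  define \<tau> where "\<tau> = min d0 (e/2)"
  have \<tau>: "0 < \<tau>" "\<tau> < e" "\<tau> \<le> d0" using g0(3) e by (auto simp: \<tau>_def)
  define c where "c = (e + e/2) / \<tau>"
  have c: "c > 0" "c * \<tau> = e + e/2" using e \<tau> by (auto simp: c_def)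
  obtain \<psi> where \<psi>: "continuous_on UNIV \<psi>"
    "\<And>t k::int. \<bar>t - (0 + 2 * e * of_int k)\<bar> \<le> \<tau> \<Longrightarrow>
       \<psi> t = (0 + 2 * e * of_int k) + c * (t - (0 + 2 * e * of_int k))"
    "\<And>t k::int. \<bar>\<psi> t - (0 + 2 * e * of_int k)\<bar> < e - e/2 \<Longrightarrow> \<bar>t - (0 + 2 * e * of_int k)\<bar> \<le> \<tau>"
    "\<And>t. \<bar>\<psi> t - t\<bar> \<le> 2 * e + e/2"
    using exists_zigzag[OF \<tau>(1,2), of "e/2" 0] e unfolding c_def by (metis half_gt_zero less_imp_le)
  define g where "g x = (\<chi> j. \<psi> (g0 x $ j))" for x
  have g: "continuous_map X euclidean g"
    unfolding g_def by (rule continuous_map_compose_UNIV[OF g0(1) continuous_on_vec_map[OF \<psi>(1)]])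
  have "near (topspace X) (2 * e + e/2) g0 g"
    unfolding g_def by (rule near_vec_map[OF \<psi>(4)])
  then have fg: "near (topspace X) \<epsilon> f g"
    using near_mono[OF near_trans[OF g0(2)], of "topspace X" "2 * e + e/2" g "topspace X" \<epsilon>] e by simp
  have "\<exists>b>0. stable_value X h (topspace X) y b"
    if h: "continuous_map X euclidean h" and gh: "near (topspace X) (e/4) g h"
      and sub: "ball y r \<subseteq> h ` topspace X" for h y
  proof -
    have hM: "\<bar>h x $ j\<bar> \<le> M + \<epsilon> + e" if x: "x \<in> topspace X" for x j
      using M[OF x, of j] nearD[OF fg x, of j] nearD[OF gh x, of j] e by linarith
    have "y \<in> h ` topspace X" using sub \<open>r > 0\<close> by (meson centre_in_ball subsetD)
    then obtain x0 where x0: "x0 \<in> topspace X" "y = h x0" by blast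
    have "\<bar>y $ j\<bar> \<le> M + \<epsilon> + 2 * e" for j using hM[OF x0(1), of j] x0(2) e by simp
    then obtain \<kappa> :: "'n \<Rightarrow> int" where \<kappa>: "(\<chi> j. 0 + 2 * e * of_int (\<kappa> j)) \<in> G"
      "\<And>j. \<bar>y $ j - (0 + 2 * e * of_int (\<kappa> j))\<bar> \<le> e" using G(2)[of y] by blast
    define z :: "real^'n" where "z = (\<chi> j. 0 + 2 * e * of_int (\<kappa> j))"
    have zj: "z $ j = 0 + 2 * e * of_int (\<kappa> j)" for j by (simp add: z_def)
    have yz: "\<bar>y $ j - z $ j\<bar> \<le> e" for j using \<kappa>(2) zj by simp
    have "norm (y - z) \<le> (\<Sum>j\<in>UNIV. \<bar>(y - z) $ j\<bar>)" by (rule norm_le_l1_cart)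
    also have "\<dots> \<le> (\<Sum>j\<in>(UNIV::'n set). e)" by (rule sum_mono) (use yz in simp)
    finally have "z \<in> ball y r" using er by (simp add: dist_norm)
    then obtain x where x: "x \<in> topspace X" "z = h x" using sub by blast
    have "\<bar>g0 x $ j - z $ j\<bar> \<le> \<tau>" for j
    proof -
      \<comment> \<open>As \<open>h x = z\<close>, the distance is at most \<open>e/4\<close>, below
        the threshold left by the overshoot.\<close>
      have "\<bar>\<psi> (g0 x $ j) - z $ j\<bar> < e - e/2"
        using nearD[OF gh x(1), of j] x(2) e(1) by (simp add: g_def)
      then show ?thesis using \<psi>(3) unfolding zj by blast
    qed
    then have "\<not> (\<exists>j. \<bar>g0 x $ j - z $ j\<bar> > d0)" using \<tau>(3) by (meson not_less order_trans)
    then have st: "stable_value X g0 (topspace X) z d0"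
      using dich[of "topspace X" z] \<kappa>(1) x(1) unfolding z_def by blast
    \<comment> \<open>The overshoot \<open>e/2\<close> is the stability margin:
      \<open>c * \<tau> - e/2 = e\<close> still reaches the whole cell.\<close>
    have "stable_value X g {x \<in> topspace X. \<forall>j. \<bar>g0 x $ j - z $ j\<bar> \<le> \<tau>} y (e/2)"
    proof (rule stable_value_window[OF st g0(1) \<tau>(1,3) c(1)])
      show "g x = z + c *\<^sub>R (g0 x - z)" if "\<And>j. \<bar>g0 x $ j - z $ j\<bar> \<le> \<tau>" for x
        using \<psi>(2) that unfolding g_def by (simp add: vec_eq_iff zj)
      show "\<bar>y $ j - z $ j\<bar> \<le> c * \<tau> - e/2" for j using yz[of j] c(2) by simp
    qed (use e in auto)
    then have "stable_value X g (topspace X) y (e/2)"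
      by (rule stable_value_mono) auto
    then have "stable_value X h (topspace X) y (e/4)"
      by (rule stable_value_perturb[OF _ gh]) simp
    then show ?thesis using e(1) by (intro exI[of _ "e/4"]) simp
  qed
  moreover have "e / 4 > 0" using e by simp
  ultimately show ?thesis using that[OF g fg] by blast
qed

text \<open>The fixed radius \<open>b\<close> makes the centre of the cell of \<open>y\<close> and
  that of a diagonal neighbour stable for \<open>f\<close>. With overshoot \<open>3 * e\<close> the
  disjoint windows around both are stretched over \<open>y\<close>.\<close>

lemma stable_value_splitting_perturbation:
  fixes f :: "'a \<Rightarrow> real^'n"
  assumes f: "continuous_map X euclidean f" and "\<epsilon> > 0" "b > 0"
  obtains g d where "continuous_map X euclidean g" "near (topspace X) \<epsilon> f g" "d > 0"
    "\<And>h C y. continuous_map X euclidean h \<Longrightarrow> near (topspace X) d g h \<Longrightarrow> closedin X C \<Longrightarrow>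
       stable_value X h C y b \<Longrightarrow>
       \<exists>C1 C2 d'. closedin X C1 \<and> closedin X C2 \<and> C1 \<subseteq> C \<and> C2 \<subseteq> C \<and> C1 \<inter> C2 = {} \<and> d' > 0 \<and>
         stable_value X h C1 y d' \<and> stable_value X h C2 y d'"
proof -
  \<comment> \<open>Passing from \<open>h\<close> to \<open>f\<close> costs
    \<open>5 * e + e/2\<close>, and \<open>10 * e \<le> b\<close> leaves at least
    \<open>4 * e\<close>; moving to a centre within \<open>3 * e\<close> of \<open>y\<close> leaves
    \<open>e\<close>.\<close>
  define e where "e = min (\<epsilon> / 5) (b / 10)"
  have e: "e > 0" "5 * e \<le> \<epsilon>" "10 * e \<le> b" using assms by (auto simp: e_def)
  have pos: "0 < e/2" "e/2 < e" "0 \<le> 3 * e" using e(1) by auto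
  obtain \<psi> where \<psi>: "continuous_on UNIV \<psi>"
    "\<And>t k::int. \<bar>t - (0 + 2 * e * of_int k)\<bar> \<le> e/2 \<Longrightarrow>
       \<psi> t = (0 + 2 * e * of_int k) + ((e + 3 * e) / (e/2)) * (t - (0 + 2 * e * of_int k))"
    "\<And>t. \<bar>\<psi> t - t\<bar> \<le> 2 * e + 3 * e"
    by (rule exists_zigzag[OF pos, of 0]) (rule that)
  \<comment> \<open>The stretched window has half-width \<open>4 * e\<close>: a reach of
    \<open>3 * e\<close> plus a margin \<open>e\<close>.\<close>
  define c where "c = (e + 3 * e) / (e/2)"
  have c: "c > 0" "c * (e/2) = 4 * e" using e by (auto simp: c_def)
  define g where "g x = (\<chi> j. \<psi> (f x $ j))" for x
  have g: "continuous_map X euclidean g"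
    unfolding g_def by (rule continuous_map_compose_UNIV[OF f continuous_on_vec_map[OF \<psi>(1)]])
  have fg0: "near (topspace X) (5 * e) f g"
    using near_vec_map[of \<psi> "5 * e" "topspace X" f] \<psi>(3) unfolding g_def by simp
  then have fg: "near (topspace X) \<epsilon> f g" using e(2) by (rule near_mono[OF _ order_refl])
  have "\<exists>C1 C2 d'. closedin X C1 \<and> closedin X C2 \<and> C1 \<subseteq> C \<and> C2 \<subseteq> C \<and> C1 \<inter> C2 = {} \<and> d' > 0 \<and>
         stable_value X h C1 y d' \<and> stable_value X h C2 y d'"
    if h: "continuous_map X euclidean h" and gh: "near (topspace X) (e/2) g h" and C: "closedin X C"
      and st: "stable_value X h C y b" for h C y
  proof -
    have CX: "C \<subseteq> topspace X" using C by (rule closedin_subset)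
    have "near C (5 * e + e/2) f h" by (rule near_mono[OF near_trans[OF fg0 gh] CX order_refl])
    from stable_value_perturb[OF st near_sym[OF this], of "4 * e"]
    have stf: "stable_value X f C y (4 * e)" using e by simp
    have "\<forall>j. \<exists>k::int. \<bar>y $ j - (0 + 2 * e * of_int k)\<bar> \<le> e" using round_grid[OF e(1)] by blast
    then obtain \<kappa> where \<kappa>: "\<And>j. \<bar>y $ j - (0 + 2 * e * of_int (\<kappa> j :: int))\<bar> \<le> e" by metis
    \<comment> \<open>The index \<open>i\<close> shifts the centre in every coordinate at
      once.\<close>
    define W where "W i = {x \<in> C. \<forall>j. \<bar>f x $ j - (\<chi> j. 0 + 2 * e * of_int (\<kappa> j + i)) $ j\<bar> \<le> e/2}"
      for i :: int
    have W: "stable_value X h (W i) y (e/2)" if i: "i = 0 \<or> i = 1" for i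
    proof -
      define z :: "real^'n" where "z = (\<chi> j. 0 + 2 * e * of_int (\<kappa> j + i))"
      have zj: "z $ j = 0 + 2 * e * of_int (\<kappa> j + i)" for j by (simp add: z_def)
      have yz: "\<bar>y $ j - z $ j\<bar> \<le> 3 * e" for j
        using \<kappa>[of j] i e(1) unfolding zj by (auto simp: algebra_simps)
      have "stable_value X f C z e"
        using stable_value_translate[OF stf yz, of e] by simp
      then have "stable_value X g {x \<in> C. \<forall>j. \<bar>f x $ j - z $ j\<bar> \<le> e/2} y e"
      proof (rule stable_value_window[OF _ f _ _ c(1)])
        show "g x = z + c *\<^sub>R (f x - z)" if "\<And>j. \<bar>f x $ j - z $ j\<bar> \<le> e/2" for x
        proof -
          have "\<psi> (f x $ j) = z $ j + c * (f x $ j - z $ j)" for j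
            unfolding zj c_def by (rule \<psi>(2)) (use that[of j] zj in simp)
          then show ?thesis unfolding g_def by (simp add: vec_eq_iff)
        qed
        show "\<bar>y $ j - z $ j\<bar> \<le> c * (e/2) - e" for j using yz[of j] unfolding c(2) by simp
      qed (use e in auto)
      then have "stable_value X g (W i) y e" by (simp only: W_def z_def)
      moreover have "near (W i) (e/2) g h" by (rule near_mono[OF gh]) (use CX in \<open>auto simp: W_def\<close>)
      ultimately show ?thesis by (rule stable_value_perturb) simp
    qed
    have "W 0 \<inter> W 1 = {}"
    proof (rule ccontr)
      assume "W 0 \<inter> W 1 \<noteq> {}"
      then obtain x where x: "x \<in> W 0" "x \<in> W 1" by blast
      \<comment> \<open>Any single coordinate separates the windows: the centres differ there by
        \<open>2 * e\<close>, the half-widths are \<open>e/2\<close>.\<close>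
      fix j
      define a where "a = 2 * e * of_int (\<kappa> j)"
      have "\<bar>f x $ j - a\<bar> \<le> e/2" using x(1) by (simp add: W_def a_def)
      moreover have "\<bar>f x $ j - (a + 2 * e)\<bar> \<le> e/2" using x(2) by (simp add: W_def a_def distrib_left)
      ultimately show False using e(1) by linarith
    qed
    moreover have "closedin X (W i)" for i
      unfolding W_def by (rule closedin_window[OF C f])
    moreover have "W i \<subseteq> C" for i unfolding W_def by blast
    moreover have "e/2 > 0" using e by simp
    ultimately show ?thesis
      using W[of 0] W[of 1] by (intro exI[of _ "W 0"] exI[of _ "W 1"] exI[of _ "e/2"]) simp
  qed
  moreover have "e/2 > 0" using e by simp
  ultimately show ?thesis using that[OF g fg] by blast
qed

text \<open>The \<open>N + 1\<close> offsets divide the period \<open>2 * e\<close> equally, so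
  walls of different grids are at least \<open>2 * e / (N + 1)\<close> apart. Here \<open>a\<close>
  is within \<open>2 * d\<close> of a wall of each of two grids, too close for the bound on
  \<open>d\<close>.\<close>

lemma offset_grids_separated:
  fixes a e d :: real and k k' :: int
  assumes "e > 0" and "i \<le> N" "i' \<le> N" "i \<noteq> i'" and d: "4 * d * real (N + 1) \<le> e"
    and i: "e - 2 * d < \<bar>a - (2 * e * real i / real (N + 1) + 2 * e * of_int k)\<bar>"
      "\<bar>a - (2 * e * real i / real (N + 1) + 2 * e * of_int k)\<bar> \<le> e"
    and i': "e - 2 * d < \<bar>a - (2 * e * real i' / real (N + 1) + 2 * e * of_int k')\<bar>"
      "\<bar>a - (2 * e * real i' / real (N + 1) + 2 * e * of_int k')\<bar> \<le> e"
  shows False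
proof -
  \<comment> \<open>Every wall is written as a right wall; the left wall of cell \<open>k\<close> is
    the right wall of cell \<open>k - 1\<close>.\<close>
  have *: "\<exists>m::int. \<bar>a - (2 * e * real i / real (N + 1) + e + 2 * e * of_int m)\<bar> < 2 * d"
    if b: "e - 2 * d < \<bar>a - (2 * e * real i / real (N + 1) + 2 * e * of_int k)\<bar>"
      "\<bar>a - (2 * e * real i / real (N + 1) + 2 * e * of_int k)\<bar> \<le> e" for i k
  proof (cases "a - (2 * e * real i / real (N + 1) + 2 * e * of_int k) \<ge> 0")
    case True
    then show ?thesis using b by (intro exI[of _ k]) linarith
  next
    case False
    have "2 * e * of_int (k - 1) = 2 * e * of_int k - 2 * e" by (simp add: algebra_simps)
    then show ?thesis using b False by (intro exI[of _ "k - 1"]) linarith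
  qed
  obtain m where m: "\<bar>a - (2 * e * real i / real (N + 1) + e + 2 * e * of_int m)\<bar> < 2 * d"
    using *[OF i] by blast
  obtain m' where m': "\<bar>a - (2 * e * real i' / real (N + 1) + e + 2 * e * of_int m')\<bar> < 2 * d"
    using *[OF i'] by blast
  \<comment> \<open>The difference of the two walls in units of \<open>2 * e / (N + 1)\<close>;
    nonzero since \<open>i\<close> and \<open>i'\<close> are distinct residues modulo
    \<open>N + 1\<close>.\<close>
  define q where "q = int i - int i' + (m - m') * int (N + 1)"
  have "q \<noteq> 0"
  proof
    assume "q = 0"
    then have "int i' - int i = (m - m') * int (N + 1)" by (simp add: q_def)
    then have "int (N + 1) dvd int i' - int i" by simp
    moreover have "\<bar>int i' - int i\<bar> < int (N + 1)" using assms(2,3) by linarith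
    ultimately have "int i' - int i = 0" using zdvd_imp_le by (metis abs_dvd_iff dvd_abs_iff not_le zero_less_abs_iff)
    then show False using assms(4) by simp
  qed
  then have "1 \<le> \<bar>q\<bar>" by linarith
  then have q: "1 \<le> \<bar>of_int q :: real\<bar>" by linarith
  define D where "D = (2 * e * real i / real (N + 1) + 2 * e * of_int m) -
      (2 * e * real i' / real (N + 1) + 2 * e * of_int m')"
  have "\<bar>D\<bar> < 4 * d" using m m' unfolding D_def by linarith
  moreover have "D * real (N + 1) = 2 * e * of_int q"
  proof -
    define n where "n = real (N + 1)"
    have n: "n > 0" by (simp add: n_def)
    have q: "real_of_int q = real i - real i' + (of_int m - of_int m') * n"
      by (simp add: q_def n_def)
    show ?thesis
      unfolding D_def n_def[symmetric] q using n by (simp add: field_simps)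
  qed
  ultimately have "\<bar>2 * e * of_int q\<bar> < 4 * d * real (N + 1)"
    by (metis abs_mult abs_of_nat mult_strict_right_mono of_nat_0_less_iff zero_less_Suc Suc_eq_plus1)
  moreover have "2 * e * 1 \<le> 2 * e * \<bar>of_int q\<bar>" using q assms(1) by (intro mult_left_mono) auto
  moreover have "\<bar>2 * e * of_int q\<bar> = 2 * e * \<bar>of_int q\<bar>" using assms(1) by (simp add: abs_mult)
  ultimately show False using d assms(1) by linarith
qed

text \<open>On \<open>K i\<close> the map is composed with the staircase of the \<open>i\<close>-th
  grid. If \<open>y\<close> is deep inside a cell of that grid, attaining \<open>y\<close> on
  \<open>K i\<close> forces the cell centre, and with it \<open>y\<close>, to be stable. An unstable
  common value is thus near a wall of every grid.\<close>

lemma multiple_value_perturbation: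
  fixes f :: "'a \<Rightarrow> real^'n" and K :: "nat \<Rightarrow> 'a set"
  assumes X: "compact_space X" "normal_space X" and f: "continuous_map X euclidean f" and "\<epsilon> > 0"
    and K: "\<And>i. i \<le> CARD('n) \<Longrightarrow> closedin X (K i)"
    and dj: "\<And>i j. i \<le> CARD('n) \<Longrightarrow> j \<le> CARD('n) \<Longrightarrow> i \<noteq> j \<Longrightarrow> disjnt (K i) (K j)"
  obtains g d where "continuous_map X euclidean g" "near (topspace X) \<epsilon> f g" "d > 0"
    "\<And>h y. continuous_map X euclidean h \<Longrightarrow> near (topspace X) d g h \<Longrightarrow>
       (\<And>i. i \<le> CARD('n) \<Longrightarrow> y \<in> h ` K i) \<Longrightarrow> \<exists>b>0. stable_value X h (topspace X) y b"
proof -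
  \<comment> \<open>The scale \<open>e\<close> is such that \<open>N + 1\<close> corrections of size
    \<open>2 * e\<close> add up to \<open>\<epsilon>/2\<close>.\<close>
  define N where "N = CARD('n)"
  define e where "e = \<epsilon> / (4 * real (N + 1))"
  have scale: "4 * s * (a / (4 * s)) = a" "4 * (a / (4 * s)) * s = a" if "s > 0" for a s :: real
    using that by auto
  have e: "e > 0" "4 * real (N + 1) * e = \<epsilon>"
    using assms(4) scale(1)[of "real (N + 1)" \<epsilon>] by (simp_all only: e_def) simp_all
  have e\<epsilon>: "4 * e \<le> \<epsilon>"
  proof -
    have "4 * e * 1 \<le> 4 * e * real (N + 1)" using e(1) by (intro mult_left_mono) auto
    then show ?thesis using e(2) by (simp add: mult_ac)
  qed
  define d where "d = e / (4 * real (N + 1))"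
  have d: "d > 0" "4 * d * real (N + 1) = e"
    using e(1) scale(2)[of "real (N + 1)" e] by (simp_all only: d_def) simp_all
  have de: "4 * d \<le> e"
  proof -
    have "4 * d * 1 \<le> 4 * d * real (N + 1)" using d(1) by (intro mult_left_mono) auto
    then show ?thesis using d(2) by (simp add: mult_ac)
  qed
  define t where "t i = 2 * e * real i / real (N + 1)" for i
  obtain M where M: "\<And>x j. x \<in> topspace X \<Longrightarrow> \<bar>f x $ j\<bar> \<le> M"
    using continuous_map_bounded[OF X(1) f] by blast
  have "\<exists>G. finite G \<and> (\<forall>y::real^'n. (\<forall>j. \<bar>y $ j\<bar> \<le> M + \<epsilon> + d) \<longrightarrow>
       (\<exists>\<kappa>::'n \<Rightarrow> int. (\<chi> j. t i + 2 * e * of_int (\<kappa> j)) \<in> G \<and>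
         (\<forall>j. \<bar>y $ j - (t i + 2 * e * of_int (\<kappa> j))\<bar> \<le> e)))" for i
    by (rule finite_grid[OF e(1), of "M + \<epsilon> + d" "t i"]) blast
  then obtain G :: "nat \<Rightarrow> (real^'n) set" where G: "\<And>i. finite (G i)"
    "\<And>i y. (\<forall>j. \<bar>y $ j\<bar> \<le> M + \<epsilon> + d) \<Longrightarrow>
       \<exists>\<kappa>::'n \<Rightarrow> int. (\<chi> j. t i + 2 * e * of_int (\<kappa> j)) \<in> G i \<and>
         (\<forall>j. \<bar>y $ j - (t i + 2 * e * of_int (\<kappa> j))\<bar> \<le> e)" by metis
  \<comment> \<open>Each \<open>K i\<close> is paired with the points of its own grid only.\<close>
  define F where "F = (\<Union>i\<in>{..N}. {K i} \<times> G i)"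
  have finF: "finite F" using G(1) by (auto simp: F_def)
  have clF: "\<forall>(C, z)\<in>F. closedin X C" using K by (auto simp: F_def N_def)
  obtain g0 d0 where g0: "continuous_map X euclidean g0" "\<And>A. near A (\<epsilon>/2) f g0" "d0 > 0"
    and dich: "\<And>C z. (C, z) \<in> F \<Longrightarrow>
       stable_value X g0 C z d0 \<or> (\<forall>x\<in>C. \<exists>j. \<bar>g0 x $ j - z $ j\<bar> > d0)"
    by (rule stable_or_avoided_perturbation[OF X(1) finF clF f half_gt_zero[OF \<open>\<epsilon> > 0\<close>]]) blast
  define \<tau> where "\<tau> = min d0 (e/2)"
  have \<tau>: "0 < \<tau>" "\<tau> < e" "\<tau> \<le> d0" using g0(3) e by (auto simp: \<tau>_def)
  define c where "c = (e + 0) / \<tau>"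
  have c: "c > 0" "c * \<tau> = e" using e \<tau> by (auto simp: c_def)
  have "\<exists>\<psi>. continuous_on UNIV \<psi> \<and>
    (\<forall>s. \<forall>k::int. \<bar>s - (t i + 2 * e * of_int k)\<bar> \<le> \<tau> \<longrightarrow>
       \<psi> s = (t i + 2 * e * of_int k) + c * (s - (t i + 2 * e * of_int k))) \<and>
    (\<forall>s. \<forall>k::int. \<bar>\<psi> s - (t i + 2 * e * of_int k)\<bar> < e - 0 \<longrightarrow> \<bar>s - (t i + 2 * e * of_int k)\<bar> \<le> \<tau>) \<and>
    (\<forall>s. \<bar>\<psi> s - s\<bar> \<le> 2 * e + 0)" for i
    unfolding c_def by (rule exists_zigzag[OF \<tau>(1,2) order_refl, of "t i"]) blast
  then obtain \<psi> where \<psi>: "\<And>i. continuous_on UNIV (\<psi> i)"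
    "\<And>i s. \<And>k::int. \<bar>s - (t i + 2 * e * of_int k)\<bar> \<le> \<tau> \<Longrightarrow>
       \<psi> i s = (t i + 2 * e * of_int k) + c * (s - (t i + 2 * e * of_int k))"
    "\<And>i s. \<And>k::int. \<bar>\<psi> i s - (t i + 2 * e * of_int k)\<bar> < e - 0 \<Longrightarrow>
       \<bar>s - (t i + 2 * e * of_int k)\<bar> \<le> \<tau>"
    "\<And>i s. \<bar>\<psi> i s - s\<bar> \<le> 2 * e + 0"
    by metis
  \<comment> \<open>Urysohn functions combine the staircases into one continuous map that equals the
    \<open>i\<close>-th composition on \<open>K i\<close>.\<close>
  define sep where "sep i u \<longleftrightarrow> continuous_map X euclideanreal u \<and>
      (\<forall>x\<in>topspace X. 0 \<le> u x \<and> u x \<le> (1::real)) \<and>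
      (\<forall>x\<in>K i. u x = 1) \<and> (\<forall>j\<in>{..N} - {i}. \<forall>x\<in>K j. u x = 0)" for i u
  have "\<exists>u. sep i u" if i: "i \<in> {..N}" for i
  proof -
    have c1: "closedin X (\<Union>j\<in>{..N} - {i}. K j)" using K by (intro closedin_Union) (auto simp: N_def)
    have c2: "closedin X (K i)" using K i by (simp add: N_def)
    have "disjnt (\<Union>j\<in>{..N} - {i}. K j) (K i)" using dj i by (auto simp: N_def disjnt_iff)
    from Urysohn_lemma[OF X(2) c1 c2 this, of 0 1] obtain u where
      u: "continuous_map X (top_of_set {0..1::real}) u"
        "u ` (\<Union>j\<in>{..N} - {i}. K j) \<subseteq> {0}" "u ` K i \<subseteq> {1}" by auto
    then show ?thesis
      unfolding sep_def by (intro exI[of _ u]) (auto simp: continuous_map_in_subtopology image_subset_iff)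
  qed
  then obtain u where "\<And>i. i \<in> {..N} \<Longrightarrow> sep i (u i)" using bchoice[of "{..N}" sep] by blast
  then have u: "\<And>i. i \<le> N \<Longrightarrow> continuous_map X euclideanreal (u i)"
    "\<And>i x. i \<le> N \<Longrightarrow> x \<in> topspace X \<Longrightarrow> 0 \<le> u i x \<and> u i x \<le> 1"
    "\<And>i x. i \<le> N \<Longrightarrow> x \<in> K i \<Longrightarrow> u i x = 1"
    "\<And>i j x. i \<le> N \<Longrightarrow> j \<le> N \<Longrightarrow> j \<noteq> i \<Longrightarrow> x \<in> K j \<Longrightarrow> u i x = 0"
    unfolding sep_def by auto
  define w where "w i x = (\<chi> j. \<psi> i (g0 x $ j))" for i x
  have w: "continuous_map X euclidean (w i)" for i
    unfolding w_def by (rule continuous_map_compose_UNIV[OF g0(1) continuous_on_vec_map[OF \<psi>(1)]])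
  define g where "g x = g0 x + (\<Sum>i\<le>N. u i x *\<^sub>R (w i x - g0 x))" for x
  have g: "continuous_map X euclidean g"
    unfolding g_def using u(1) w g0(1)
    by (intro continuous_map_add continuous_map_sum continuous_map_scaleR continuous_map_diff) auto
  have gK: "g x = w i x" if x: "i \<le> N" "x \<in> K i" for i x
  proof -
    have "(\<Sum>i'\<le>N. u i' x *\<^sub>R (w i' x - g0 x)) = (\<Sum>i'\<le>N. if i' = i then w i x - g0 x else 0)"
      by (rule sum.cong) (use u(3,4) x in auto)
    also have "\<dots> = w i x - g0 x" using x(1) by simp
    finally show ?thesis by (simp add: g_def)
  qed
  have "near (topspace X) (\<epsilon>/2) g0 g"
    unfolding near_def
  proof (intro ballI allI)
    fix x j assume x: "x \<in> topspace X"
    have "\<bar>g0 x $ j - g x $ j\<bar> = \<bar>\<Sum>i\<le>N. u i x * (\<psi> i (g0 x $ j) - g0 x $ j)\<bar>"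
      by (simp add: g_def w_def)
    also have "\<dots> \<le> (\<Sum>i\<le>N. \<bar>u i x * (\<psi> i (g0 x $ j) - g0 x $ j)\<bar>)" by (rule sum_abs)
    also have "\<dots> \<le> (\<Sum>i\<le>N. 2 * e)"
    proof (rule sum_mono)
      fix i assume "i \<in> {..N}"
      then have "0 \<le> u i x" "u i x \<le> 1" using u(2) x by auto
      then have "u i x * \<bar>\<psi> i (g0 x $ j) - g0 x $ j\<bar> \<le> 1 * (2 * e)"
        using \<psi>(4)[of i "g0 x $ j"] e(1) by (intro mult_mono) auto
      then show "\<bar>u i x * (\<psi> i (g0 x $ j) - g0 x $ j)\<bar> \<le> 2 * e"
        using \<open>0 \<le> u i x\<close> by (simp add: abs_mult)
    qed
    also have "\<dots> = (4 * real (N + 1) * e) / 2" by simp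
    also have "\<dots> = \<epsilon>/2" by (simp only: e(2))
    finally show "\<bar>g0 x $ j - g x $ j\<bar> \<le> \<epsilon>/2" .
  qed
  then have fg: "near (topspace X) \<epsilon> f g"
    using near_mono[OF near_trans[OF g0(2)] order_refl, of "topspace X" "\<epsilon>/2" g \<epsilon>] by simp
  have "\<exists>b>0. stable_value X h (topspace X) y b"
    if h: "continuous_map X euclidean h" and gh: "near (topspace X) d g h"
      and y: "\<And>i. i \<le> N \<Longrightarrow> y \<in> h ` K i" for h y
  proof (rule ccontr)
    assume unstable: "\<not> ?thesis"
    have KX: "K i \<subseteq> topspace X" if "i \<le> N" for i
      using K closedin_subset that unfolding N_def by blast
    have "\<bar>y $ j\<bar> \<le> M + \<epsilon> + d" for j
    proof -
      obtain x where x: "x \<in> topspace X" "y = h x" using y[of 0] KX[of 0] by auto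
      show ?thesis
        using M[OF x(1), of j] nearD[OF fg x(1), of j] nearD[OF gh x(1), of j]
        unfolding x(2) by linarith
    qed
    then have "\<exists>\<kappa>::'n \<Rightarrow> int. (\<chi> j. t i + 2 * e * of_int (\<kappa> j)) \<in> G i \<and>
         (\<forall>j. \<bar>y $ j - (t i + 2 * e * of_int (\<kappa> j))\<bar> \<le> e)" for i using G(2) by blast
    then obtain \<kappa> :: "nat \<Rightarrow> 'n \<Rightarrow> int" where \<kappa>: "\<And>i. (\<chi> j. t i + 2 * e * of_int (\<kappa> i j)) \<in> G i"
      "\<And>i j. \<bar>y $ j - (t i + 2 * e * of_int (\<kappa> i j))\<bar> \<le> e" by metis
    \<comment> \<open>Otherwise \<open>y\<close> is at least \<open>2 * d\<close> from the walls of
      its cell: \<open>g x\<close> is then strictly inside the cell, and the stability radius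
      \<open>2 * d\<close> for \<open>g\<close> leaves \<open>d\<close> for
      \<open>h\<close>.\<close>
    have "\<exists>j. e - 2 * d < \<bar>y $ j - (t i + 2 * e * of_int (\<kappa> i j))\<bar>" if i: "i \<le> N" for i
    proof (rule ccontr)
      assume deep: "\<not> ?thesis"
      define z :: "real^'n" where "z = (\<chi> j. t i + 2 * e * of_int (\<kappa> i j))"
      have zj: "z $ j = t i + 2 * e * of_int (\<kappa> i j)" for j by (simp add: z_def)
      have yz: "\<bar>y $ j - z $ j\<bar> \<le> e - 2 * d" for j using deep unfolding zj by (simp add: not_less)
      obtain x where x: "x \<in> K i" "y = h x" using y[OF i] by blast
      have xX: "x \<in> topspace X" using x(1) KX[OF i] by blast
      have "\<bar>g0 x $ j - z $ j\<bar> \<le> \<tau>" for j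
      proof -
        have "g x $ j = \<psi> i (g0 x $ j)" using gK[OF i x(1)] by (simp add: w_def)
        then have "\<bar>\<psi> i (g0 x $ j) - z $ j\<bar> < e - 0"
          using nearD[OF gh xX, of j] x(2) yz[of j] d(1) by simp
        then show ?thesis using \<psi>(3) unfolding zj by blast
      qed
      then have "\<not> (\<exists>j. \<bar>g0 x $ j - z $ j\<bar> > d0)" using \<tau>(3) by (meson not_less order_trans)
      moreover have "(K i, z) \<in> F" using \<kappa>(1)[of i] i unfolding F_def z_def by auto
      ultimately have st: "stable_value X g0 (K i) z d0" using dich x(1) by blast
      have "stable_value X g {x \<in> K i. \<forall>j. \<bar>g0 x $ j - z $ j\<bar> \<le> \<tau>} y (2 * d)"
      proof (rule stable_value_window[OF st g0(1) \<tau>(1,3) c(1)])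
        show "g x = z + c *\<^sub>R (g0 x - z)" if "x \<in> K i" "\<And>j. \<bar>g0 x $ j - z $ j\<bar> \<le> \<tau>" for x
          using \<psi>(2) that gK[OF i] unfolding w_def by (simp add: vec_eq_iff zj)
        show "\<bar>y $ j - z $ j\<bar> \<le> c * \<tau> - 2 * d" for j using yz[of j] unfolding c(2) .
      qed (use d in auto)
      then have "stable_value X g (topspace X) y (2 * d)"
        by (rule stable_value_mono) (use KX[OF i] in auto)
      then have "stable_value X h (topspace X) y d"
        by (rule stable_value_perturb[OF _ gh]) simp
      then show False using unstable d(1) by blast
    qed
    then obtain J where J: "\<And>i. i \<le> N \<Longrightarrow> e - 2 * d < \<bar>y $ J i - (t i + 2 * e * of_int (\<kappa> i (J i)))\<bar>"
      by metis
    \<comment> \<open>There are \<open>N + 1\<close> grids but only \<open>N\<close> axes.\<close>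
    have "\<not> inj_on J {..N}"
    proof (rule pigeonhole)
      have "card (J ` {..N}) \<le> N" unfolding N_def by (rule card_mono) auto
      then show "card (J ` {..N}) < card {..N}" by simp
    qed
    then obtain i i' where ii: "i \<le> N" "i' \<le> N" "i \<noteq> i'" "J i = J i'" by (auto simp: inj_on_def)
    show False
      using offset_grids_separated[OF e(1) ii(1-3) eq_refl[OF d(2)],
          of "y $ J i" "\<kappa> i (J i)" "\<kappa> i' (J i)"]
        J[OF ii(1)] J[OF ii(2)] \<kappa>(2)[where i = i and j = "J i"] \<kappa>(2)[where i = i' and j = "J i"]
      unfolding t_def ii(4)[symmetric] by blast
  qed
  then show ?thesis using that[OF g fg d(1)] unfolding N_def by blast
qed

section \<open>Generic maps\<close>

text \<open>Each member of \<open>\<P>\<close> holds on some ball arbitrarily close to any given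
  point, so its failure set is nowhere dense; countably many of these cover the failure set of
  \<open>Q\<close>.\<close>

lemma (in Metric_space) generic_in_mtopologyI:
  assumes "countable \<P>"
    and dense: "\<And>P f \<epsilon>. P \<in> \<P> \<Longrightarrow> f \<in> M \<Longrightarrow> \<epsilon> > 0 \<Longrightarrow>
      \<exists>g\<in>M. d f g < \<epsilon> \<and> (\<exists>\<delta>>0. \<forall>h\<in>M. d g h < \<delta> \<longrightarrow> P h)"
    and imp: "\<And>h. h \<in> M \<Longrightarrow> (\<And>P. P \<in> \<P> \<Longrightarrow> P h) \<Longrightarrow> Q h"
  shows "generic_in mtopology Q"
proof -
  \<comment> \<open>Intersecting with the failure of \<open>Q\<close> makes the union equal to the
    complement, as \<open>meager_in\<close> demands; an index coding no member of
    \<open>\<P>\<close> gives the empty set.\<close>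
  define N where "N k = {h \<in> M. \<not> Q h \<and> (\<exists>P\<in>\<P>. to_nat_on \<P> P = k \<and> \<not> P h)}" for k
  have "nowhere_dense_in mtopology (N k)" for k
    unfolding nowhere_dense_in_def
  proof (intro conjI)
    show "N k \<subseteq> topspace mtopology" by (auto simp: N_def)
    show "mtopology interior_of (mtopology closure_of N k) = {}"
    proof (rule ccontr)
      assume "\<not> ?thesis"
      then obtain f where f: "f \<in> mtopology interior_of (mtopology closure_of N k)" by blast
      moreover have "openin mtopology (mtopology interior_of (mtopology closure_of N k))" by simp
      ultimately obtain \<epsilon> where \<epsilon>: "\<epsilon> > 0" "f \<in> M"
        "mball f \<epsilon> \<subseteq> mtopology interior_of (mtopology closure_of N k)"
        unfolding openin_mtopology by blast
      then have sub: "mball f \<epsilon> \<subseteq> mtopology closure_of N k"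
        using interior_of_subset by fastforce
      have "f \<in> mtopology closure_of N k" using sub \<epsilon> by auto
      then obtain h0 where "h0 \<in> N k" unfolding metric_closure_of using zero_less_one by blast
      then obtain P where P: "P \<in> \<P>" "to_nat_on \<P> P = k" by (auto simp: N_def)
      obtain g \<delta> where g: "g \<in> M" "d f g < \<epsilon>" "\<delta> > 0" and Pg: "\<And>h. h \<in> M \<Longrightarrow> d g h < \<delta> \<Longrightarrow> P h"
        using dense[OF P(1) \<epsilon>(2,1)] by blast
      have "g \<in> mtopology closure_of N k" using sub g \<epsilon>(2) by auto
      then obtain h where h: "h \<in> N k" "h \<in> mball g \<delta>"
        unfolding metric_closure_of using g(3) by blast
      then obtain P' where P': "P' \<in> \<P>" "to_nat_on \<P> P' = k" "\<not> P' h" by (auto simp: N_def)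
      then have "P' = P" using to_nat_on_inj[OF assms(1) P'(1) P(1)] P(2) by simp
      then show False using P' Pg[of h] h(2) by simp
    qed
  qed
  moreover have "topspace mtopology - {x \<in> topspace mtopology. Q x} = (\<Union>k. N k)"
    using imp by (auto simp: N_def)
  ultimately show ?thesis
    unfolding generic_in_def comeager_in_def meager_in_def by auto
qed

section \<open>Countable separating families and cardinality of compact metric spaces\<close>

lemma (in Metric_space) finite_set_separation:
  assumes "finite S" "S \<subseteq> M"
  obtains r where "r > 0" "\<And>x y. x \<in> S \<Longrightarrow> y \<in> S \<Longrightarrow> x \<noteq> y \<Longrightarrow> r \<le> d x y"
proof -
  \<comment> \<open>The element \<open>1\<close> keeps the minimum defined and positive when
    \<open>S\<close> has fewer than two points.\<close>
  let ?D = "insert 1 ((\<lambda>(x, y). d x y) ` {(x, y) \<in> S \<times> S. x \<noteq> y})"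
  have "finite {(x, y) \<in> S \<times> S. x \<noteq> y}"
    by (rule finite_subset[of _ "S \<times> S"]) (use assms(1) in auto)
  then have fin: "finite ?D" by simp
  have "Min ?D > 0" using fin assms(2) by (subst Min_gr_iff) (auto simp: mdist_pos_less subset_iff)
  moreover have "Min ?D \<le> d x y" if "x \<in> S" "y \<in> S" "x \<noteq> y" for x y
    using fin that by (intro Min_le) auto
  ultimately show ?thesis using that by blast
qed

text \<open>The closed balls of radius \<open>1/(m+1)\<close> around finite nets, for all
  \<open>m\<close>, form a countable family; once four radii are less than the least distance in
  \<open>S\<close>, balls containing different points of \<open>S\<close> are disjoint.\<close>

lemma (in Metric_space) countable_separating_family:
  assumes "compact_space mtopology"
  shows "\<exists>\<B>. countable \<B> \<and> (\<forall>B\<in>\<B>. closedin mtopology B) \<and>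
    (\<forall>S. finite S \<longrightarrow> S \<subseteq> M \<longrightarrow>
      (\<exists>\<beta>. (\<forall>x\<in>S. \<beta> x \<in> \<B> \<and> x \<in> \<beta> x) \<and>
           (\<forall>x\<in>S. \<forall>y\<in>S. x \<noteq> y \<longrightarrow> disjnt (\<beta> x) (\<beta> y))))"
proof -
  have tb: "mtotally_bounded M"
    using compactin_imp_mtotally_bounded assms by (simp add: compact_space_def)
  define r where "r m = inverse (real (Suc m))" for m
  have "\<exists>F. finite F \<and> F \<subseteq> M \<and> M \<subseteq> (\<Union>x\<in>F. mball x (r m))" for m
    using tb unfolding mtotally_bounded_def r_def by simp
  then obtain F where F: "\<And>m. finite (F m)" "\<And>m. F m \<subseteq> M" "\<And>m. M \<subseteq> (\<Union>x\<in>F m. mball x (r m))" by metis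
  define \<B> where "\<B> = (\<Union>m. (\<lambda>x. mcball x (r m)) ` F m)"
  have cb: "countable \<B>"
    unfolding \<B>_def using F(1) by (intro countable_UN countable_image) (auto intro: countable_finite)
  have cl: "closedin mtopology B" if "B \<in> \<B>" for B using that by (auto simp: \<B>_def)
  have sp: "\<exists>\<beta>. (\<forall>x\<in>S. \<beta> x \<in> \<B> \<and> x \<in> \<beta> x) \<and> (\<forall>x\<in>S. \<forall>y\<in>S. x \<noteq> y \<longrightarrow> disjnt (\<beta> x) (\<beta> y))"
    if S: "finite S" "S \<subseteq> M" for S
  proof -
    obtain s where s: "s > 0" "\<And>x y. x \<in> S \<Longrightarrow> y \<in> S \<Longrightarrow> x \<noteq> y \<Longrightarrow> s \<le> d x y"
      using finite_set_separation[OF S] by blast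
    obtain m where m: "r m < s / 4" unfolding r_def using reals_Archimedean[of "s/4"] s(1) by auto
    have "\<forall>x\<in>S. \<exists>c\<in>F m. x \<in> mball c (r m)" using F(3)[of m] S(2) by blast
    then obtain c where c: "\<And>x. x \<in> S \<Longrightarrow> c x \<in> F m" "\<And>x. x \<in> S \<Longrightarrow> x \<in> mball (c x) (r m)" by metis
    have "disjnt (mcball (c x) (r m)) (mcball (c y) (r m))" if xy: "x \<in> S" "y \<in> S" "x \<noteq> y" for x y
    proof (rule ccontr)
      assume "\<not> ?thesis"
      then obtain w where w: "w \<in> mcball (c x) (r m)" "w \<in> mcball (c y) (r m)" by (auto simp: disjnt_iff)
      have M: "x \<in> M" "y \<in> M" "c x \<in> M" "c y \<in> M" "w \<in> M" using w S xy by auto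
      have "d x y \<le> d x (c x) + d (c x) w + (d w (c y) + d (c y) y)"
        using triangle[OF M(1,3,5)] triangle[OF M(5,4,2)] triangle[OF M(1,5,2)] by linarith
      moreover have "d x (c x) < r m" "d (c y) y < r m" "d (c x) w \<le> r m" "d w (c y) \<le> r m"
        using c(2)[OF xy(1)] c(2)[OF xy(2)] w by (auto simp: commute)
      ultimately show False using s(2)[OF xy] m by linarith
    qed
    moreover have "x \<in> mcball (c x) (r m)" "mcball (c x) (r m) \<in> \<B>" if "x \<in> S" for x
      using c[OF that] by (auto simp: \<B>_def)
    ultimately show ?thesis by (intro exI[of _ "\<lambda>x. mcball (c x) (r m)"]) blast
  qed
  show ?thesis by (intro exI[of _ \<B>] conjI ballI allI impI cb cl sp)
qed

text \<open>A point is coded by the indices of the members of \<open>\<B>\<close> that contain it;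
  separation of any two points makes the code injective.\<close>

lemma (in Metric_space) compact_lepoll_continuum:
  assumes "compact_space mtopology"
  shows "M \<lesssim> (UNIV :: nat set set)"
proof -
  obtain \<B> where \<B>: "countable \<B>"
    and sp: "\<forall>S. finite S \<longrightarrow> S \<subseteq> M \<longrightarrow>
      (\<exists>\<beta>. (\<forall>x\<in>S. \<beta> x \<in> \<B> \<and> x \<in> \<beta> x) \<and>
           (\<forall>x\<in>S. \<forall>y\<in>S. x \<noteq> y \<longrightarrow> disjnt (\<beta> x) (\<beta> y)))"
    using countable_separating_family[OF assms] by (elim exE conjE)
  define \<phi> where "\<phi> x = to_nat_on \<B> ` {B \<in> \<B>. x \<in> B}" for x
  have "inj_on \<phi> M"
  proof (rule inj_onI, rule ccontr)
    fix x y assume xy: "x \<in> M" "y \<in> M" "\<phi> x = \<phi> y" "x \<noteq> y"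
    obtain \<beta> where \<beta>: "\<forall>z\<in>{x, y}. \<beta> z \<in> \<B> \<and> z \<in> \<beta> z" "disjnt (\<beta> x) (\<beta> y)"
      using sp[rule_format, of "{x, y}"] xy by auto
    have "to_nat_on \<B> (\<beta> x) \<in> \<phi> y" using \<beta>(1) xy(3) by (auto simp: \<phi>_def)
    then obtain B where B: "B \<in> \<B>" "y \<in> B" "to_nat_on \<B> (\<beta> x) = to_nat_on \<B> B" by (auto simp: \<phi>_def)
    then have "\<beta> x = B" using \<beta>(1) to_nat_on_inj[OF \<B>, of "\<beta> x" B] by simp
    then show False using \<beta> B by (auto simp: disjnt_iff)
  qed
  then show ?thesis unfolding lepoll_def by blast
qed

text \<open>A set of naturals is a branch of a binary tree of closed sets meeting \<open>A\<close>;
  by compactness each branch has a point of \<open>A\<close> in all its nodes.\<close>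

lemma cantor_scheme_lepoll:
  assumes X: "compact_space X" and A: "closedin X A" and R: "R \<in> T"
    and T: "\<And>C. C \<in> T \<Longrightarrow> closedin X C" "\<And>C. C \<in> T \<Longrightarrow> C \<inter> A \<noteq> {}"
    and split: "\<And>C. C \<in> T \<Longrightarrow> \<exists>C1\<in>T. \<exists>C2\<in>T. C1 \<subseteq> C \<and> C2 \<subseteq> C \<and> C1 \<inter> C2 = {}"
  shows "(UNIV :: nat set set) \<lesssim> A"
proof -
  obtain c1 c2 where c: "\<And>C. C \<in> T \<Longrightarrow> c1 C \<in> T" "\<And>C. C \<in> T \<Longrightarrow> c2 C \<in> T"
      "\<And>C. C \<in> T \<Longrightarrow> c1 C \<subseteq> C" "\<And>C. C \<in> T \<Longrightarrow> c2 C \<subseteq> C" "\<And>C. C \<in> T \<Longrightarrow> c1 C \<inter> c2 C = {}"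
    using split by metis
  define node where "node s = rec_nat R (\<lambda>n C. if n \<in> s then c1 C else c2 C)" for s :: "nat set"
  have node0: "node s 0 = R" for s by (simp add: node_def)
  have nodeS: "node s (Suc n) = (if n \<in> s then c1 (node s n) else c2 (node s n))" for s n
    by (simp add: node_def)
  have nodeT: "node s n \<in> T" for s n
    by (induction n) (auto simp: node0 nodeS R c)
  have "node s (Suc n) \<subseteq> node s n" for s n
    using c(3,4) nodeT by (simp add: nodeS)
  then have dec: "decseq (\<lambda>n. node s n \<inter> A)" for s
    by (intro decseq_SucI) blast
  have ne: "(\<Inter>n. node s n \<inter> A) \<noteq> {}" for s
  proof (rule compact_space_imp_nest[OF X _ _ dec])
    show "closedin X (node s n \<inter> A)" for n by (rule closedin_Int[OF T(1)[OF nodeT] A])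
    show "node s n \<inter> A \<noteq> {}" for n by (rule T(2)[OF nodeT])
  qed
  define \<phi> where "\<phi> s = (SOME x. x \<in> (\<Inter>n. node s n \<inter> A))" for s
  have \<phi>: "\<phi> s \<in> (\<Inter>n. node s n \<inter> A)" for s
    unfolding \<phi>_def some_in_eq by (rule ne)
  have "inj \<phi>"
  proof (rule injI, rule ccontr)
    fix s s' assume eq: "\<phi> s = \<phi> s'" and "s \<noteq> s'"
    then have ex: "\<exists>n. (n \<in> s) \<noteq> (n \<in> s')" by blast
    \<comment> \<open>Two branches agree up to their first difference; the next nodes are the
      disjoint children of one node.\<close>
    define n where "n = (LEAST n. (n \<in> s) \<noteq> (n \<in> s'))"
    have n: "(n \<in> s) \<noteq> (n \<in> s')" unfolding n_def by (rule LeastI_ex[OF ex])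
    have below: "(m \<in> s) = (m \<in> s')" if "m < n" for m
      using not_less_Least[of m "\<lambda>n. (n \<in> s) \<noteq> (n \<in> s')"] that unfolding n_def by blast
    have "m \<le> n \<Longrightarrow> node s m = node s' m" for m
      by (induction m) (auto simp: node0 nodeS below)
    then have "node s n = node s' n" by simp
    then have "node s (Suc n) \<inter> node s' (Suc n) = {}"
      using n c(5)[OF nodeT[of s n]] by (auto simp: nodeS)
    moreover have "\<phi> s \<in> node s (Suc n)" "\<phi> s' \<in> node s' (Suc n)" using \<phi> by blast+
    ultimately show False using eq by auto
  qed
  moreover have "range \<phi> \<subseteq> A" using \<phi> by blast
  ultimately show ?thesis unfolding lepoll_def by blast
qed

text \<open>Translation makes every point of \<open>ball y b\<close> stable with radius
  \<open>0\<close>, hence a value of \<open>h\<close> itself.\<close>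

lemma stable_value_imp_interior:
  fixes h :: "'a \<Rightarrow> real^'n"
  assumes "stable_value X h C y b" "b > 0" "continuous_map X euclidean h"
  shows "y \<in> interior (h ` C)"
proof -
  have "y' \<in> h ` C" if y': "y' \<in> ball y b" for y'
  proof -
    have yy: "\<bar>y $ j - y' $ j\<bar> \<le> b" for j
      using component_le_norm_cart[of "y - y'" j] y' by (simp add: dist_norm)
    have "stable_value X h C y' 0"
      by (rule stable_value_translate[OF assms(1) yy]) simp
    then show ?thesis by (rule stable_valueD[OF _ assms(3)]) (simp add: near_def)
  qed
  then show ?thesis using assms(2) by (intro interiorI[of "ball y b"]) auto
qed

section \<open>Transfer to the function space and the countable list of conditions\<close>

text \<open>Passes from arbitrary continuous maps and coordinatewise closeness to the points and
  metric of \<open>cfunspace\<close>; the new map is restricted to the carrier because those points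
  are extensional.\<close>

lemma cfunspace_perturbation:
  fixes f :: "'a \<Rightarrow> real^'n"
  assumes X: "compact_space X"
    and P: "\<And>f \<epsilon>. continuous_map X euclidean f \<Longrightarrow> \<epsilon> > 0 \<Longrightarrow>
      \<exists>g d. continuous_map X euclidean g \<and> near (topspace X) \<epsilon> f g \<and> d > 0 \<and>
        (\<forall>h. continuous_map X euclidean h \<longrightarrow> near (topspace X) d g h \<longrightarrow> P h)"
    and f: "f \<in> mspace (cfunspace X euclidean_metric)" and "\<epsilon> > 0"
  shows "\<exists>g\<in>mspace (cfunspace X euclidean_metric). mdist (cfunspace X euclidean_metric) f g < \<epsilon> \<and>
    (\<exists>\<delta>>0. \<forall>h\<in>mspace (cfunspace X euclidean_metric).
      mdist (cfunspace X euclidean_metric) g h < \<delta> \<longrightarrow> P h)"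
proof -
  let ?m = "euclidean_metric :: (real^'n) metric"
  let ?C = "cfunspace X ?m"
  have C: "mspace ?C = {f. f \<in> extensional (topspace X) \<and> continuous_map X euclidean f}"
    using compactin_mspace_cfunspace[of X ?m] X by (simp add: compact_space_def)
  define b where "b = \<epsilon> / (2 * real CARD('n))"
  have b: "b > 0" "real CARD('n) * b = \<epsilon> / 2" using assms(4) by (auto simp: b_def)
  obtain g d where g: "continuous_map X euclidean g" "near (topspace X) b f g" "d > 0"
    and Ph: "\<forall>h. continuous_map X euclidean h \<longrightarrow> near (topspace X) d g h \<longrightarrow> P h"
    using P[of f b] f b(1) unfolding C by blast
  define g' where "g' = restrict g (topspace X)"
  have g'g: "g' x = g x" if "x \<in> topspace X" for x using that by (simp add: g'_def)
  have "continuous_map X euclidean g'" by (rule continuous_map_eq[OF g(1)]) (simp add: g'g)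
  then have g': "g' \<in> mspace ?C" unfolding C by (simp add: g'_def)
  have "mdist ?C f g' \<le> \<epsilon> / 2"
  proof (rule mdist_cfunspace_le)
    fix x assume x: "x \<in> topspace X"
    have "norm (f x - g x) \<le> (\<Sum>j\<in>UNIV. \<bar>(f x - g x) $ j\<bar>)" by (rule norm_le_l1_cart)
    also have "\<dots> \<le> (\<Sum>j\<in>(UNIV::'n set). b)"
      by (rule sum_mono) (use nearD[OF g(2) x] in simp)
    also have "\<dots> = \<epsilon> / 2" using b(2) by simp
    finally show "mdist ?m (f x) (g' x) \<le> \<epsilon> / 2" using g'g[OF x] by (simp add: dist_norm)
  qed (use assms(4) in simp)
  then have "mdist ?C f g' < \<epsilon>" using assms(4) by simp
  moreover have "P h" if h: "h \<in> mspace ?C" "mdist ?C g' h < d" for h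
  proof -
    have "near (topspace X) d g h"
      unfolding near_def
    proof (intro ballI allI)
      fix x j assume x: "x \<in> topspace X"
      have "dist (g' x) (h x) \<le> d"
        using mdist_cfunspace_imp_mdist_le[OF g' h(1) less_imp_le[OF h(2)] x] by simp
      then show "\<bar>g x $ j - h x $ j\<bar> \<le> d"
        using component_le_norm_cart[of "g x - h x" j] g'g[OF x] by (simp add: dist_norm)
    qed
    moreover have "continuous_map X euclidean h" using h(1) unfolding C by blast
    ultimately show ?thesis using Ph by blast
  qed
  ultimately show ?thesis using g' g(3) by blast
qed

text \<open>Extensionality on the finite index set \<open>{..n}\<close>, which has
  \<open>n + 1\<close> elements, makes the set of families countable when \<open>\<B>\<close>
  is.\<close>

definition separated_families :: "'a set set \<Rightarrow> nat \<Rightarrow> (nat \<Rightarrow> 'a set) set" where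
  "separated_families \<B> n = {K \<in> {..n} \<rightarrow>\<^sub>E \<B>. \<forall>i\<le>n. \<forall>j\<le>n. i \<noteq> j \<longrightarrow> disjnt (K i) (K j)}"

text \<open>Fixing the scale \<open>1/(m+1)\<close> in the hypothesis, here and in the next
  definition, gives countably many conditions, each of which the perturbations can enforce.\<close>

definition interior_values_stable :: "'a topology \<Rightarrow> nat \<Rightarrow> ('a \<Rightarrow> real^'n) \<Rightarrow> bool" where
  "interior_values_stable X m h \<longleftrightarrow> (\<forall>y. ball y (inverse (real (Suc m))) \<subseteq> h ` topspace X \<longrightarrow>
     (\<exists>b>0. stable_value X h (topspace X) y b))"

definition stable_values_split :: "'a topology \<Rightarrow> nat \<Rightarrow> ('a \<Rightarrow> real^'n) \<Rightarrow> bool" where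
  "stable_values_split X m h \<longleftrightarrow> (\<forall>C y. closedin X C \<longrightarrow> stable_value X h C y (inverse (real (Suc m))) \<longrightarrow>
     (\<exists>C1 C2 d. closedin X C1 \<and> closedin X C2 \<and> C1 \<subseteq> C \<and> C2 \<subseteq> C \<and> C1 \<inter> C2 = {} \<and> d > 0 \<and>
         stable_value X h C1 y d \<and> stable_value X h C2 y d))"

definition multiple_values_stable :: "'a topology \<Rightarrow> (nat \<Rightarrow> 'a set) \<Rightarrow> ('a \<Rightarrow> real^'n) \<Rightarrow> bool" where
  "multiple_values_stable X K h \<longleftrightarrow>
     (\<forall>y. (\<forall>i\<le>CARD('n). y \<in> h ` K i) \<longrightarrow> (\<exists>b>0. stable_value X h (topspace X) y b))"

text \<open>The closed sets on which \<open>y\<close> is stable form a Cantor scheme: the whole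
  space is the root, stable values split, and a stable value is attained, so each set meets the
  fibre.\<close>

lemma interior_fibre_lepoll:
  fixes h :: "'a \<Rightarrow> real^'n"
  assumes X: "compact_space X" and h: "continuous_map X euclidean h"
    and int: "\<And>m. interior_values_stable X m h" and spl: "\<And>m. stable_values_split X m h"
    and y: "y \<in> interior (h ` topspace X)"
  shows "(UNIV :: nat set set) \<lesssim> {x \<in> topspace X. h x = y}"
proof -
  define T where "T = {C. closedin X C \<and> (\<exists>b>0. stable_value X h C y b)}"
  have bound: "\<exists>m. inverse (real (Suc m)) < b" if "b > 0" for b :: real
    using reals_Archimedean[OF that] .
  obtain r where r: "r > 0" "ball y r \<subseteq> h ` topspace X" using y unfolding mem_interior by blast
  obtain m where "inverse (real (Suc m)) < r" using bound[OF r(1)] by blast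
  then have "ball y (inverse (real (Suc m))) \<subseteq> h ` topspace X"
    using r(2) subset_ball[of "inverse (real (Suc m))" r y] by fastforce
  then have T0: "topspace X \<in> T"
    using int[of m] unfolding interior_values_stable_def T_def by simp
  have "closedin X {x \<in> topspace X. h x \<in> {y}}"
    by (rule closedin_continuous_map_preimage[OF h]) simp
  then have A: "closedin X {x \<in> topspace X. h x = y}" by simp
  show ?thesis
  proof (rule cantor_scheme_lepoll[OF X A T0])
    fix C assume C: "C \<in> T"
    then obtain b where b: "closedin X C" "b > 0" "stable_value X h C y b" unfolding T_def by blast
    show "closedin X C" by (rule b(1))
    have "y \<in> h ` C"
      by (rule stable_valueD[OF b(3) h]) (use b(2) in \<open>simp add: near_def\<close>)
    then show "C \<inter> {x \<in> topspace X. h x = y} \<noteq> {}" using closedin_subset[OF b(1)] by auto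
    obtain m where m: "inverse (real (Suc m)) < b" using bound[OF b(2)] by blast
    have st: "stable_value X h C y (inverse (real (Suc m)))"
      by (rule stable_value_mono[OF b(3) order_refl less_imp_le[OF m]])
    obtain C1 C2 d where "closedin X C1" "closedin X C2" "C1 \<subseteq> C" "C2 \<subseteq> C" "C1 \<inter> C2 = {}" "d > 0"
         "stable_value X h C1 y d" "stable_value X h C2 y d"
      using spl[of m, unfolded stable_values_split_def, rule_format, OF b(1) st] by (elim exE conjE)
    then show "\<exists>C1\<in>T. \<exists>C2\<in>T. C1 \<subseteq> C \<and> C2 \<subseteq> C \<and> C1 \<inter> C2 = {}"
      unfolding T_def by (intro bexI[of _ C1] bexI[of _ C2]) auto
  qed
qed

theorem theorem4p14:
  fixes K :: "'a metric"
  assumes "compact_space (mtopology_of K)"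
    and "small_inductive_dim (mtopology_of K) \<ge> ereal (real CARD('n::finite))"
  shows "generic_in (mtopology_of (cfunspace (mtopology_of K) (euclidean_metric :: (real ^ 'n) metric)))
    (\<lambda>f. (\<forall>y \<in> frontier (f ` mspace K). finite (fibre K f y) \<and> card (fibre K f y) \<le> CARD('n)) \<and>
         (\<forall>y \<in> interior (f ` mspace K). fibre K f y \<approx> (UNIV :: nat set set)))"
proof -
  interpret K: Metric_space "mspace K" "mdist K" by (rule Metric_space_mspace_mdist)
  define X where "X = mtopology_of K"
  have XK: "X = K.mtopology" by (simp add: X_def mtopology_of_def)
  have tX: "topspace X = mspace K" by (simp add: X_def)
  have X: "compact_space X" using assms(1) by (simp add: X_def)
  have nX: "normal_space X" unfolding XK by (rule K.normal_space_mtopology)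
  let ?C = "cfunspace X (euclidean_metric :: (real ^ 'n) metric)"
  interpret C: Metric_space "mspace ?C" "mdist ?C" by (rule Metric_space_mspace_mdist)
  obtain \<B> where \<B>: "countable \<B>" "\<forall>B\<in>\<B>. closedin X B"
    and sp: "\<forall>S. finite S \<longrightarrow> S \<subseteq> mspace K \<longrightarrow>
      (\<exists>\<beta>. (\<forall>x\<in>S. \<beta> x \<in> \<B> \<and> x \<in> \<beta> x) \<and>
           (\<forall>x\<in>S. \<forall>y\<in>S. x \<noteq> y \<longrightarrow> disjnt (\<beta> x) (\<beta> y)))"
    using K.countable_separating_family[OF X[unfolded XK]] unfolding XK[symmetric]
    by (elim exE conjE)
  define \<F> where "\<F> = separated_families \<B> CARD('n)"
  define \<P> :: "(('a \<Rightarrow> real^'n) \<Rightarrow> bool) set" where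
    "\<P> = range (interior_values_stable X) \<union> range (stable_values_split X) \<union>
      multiple_values_stable X ` \<F>"
  have "countable ({..CARD('n)} \<rightarrow>\<^sub>E \<B>)" by (rule countable_PiE) (use \<B>(1) in auto)
  then have "countable \<F>"
    unfolding \<F>_def separated_families_def by (rule countable_subset[rotated]) blast
  then have count: "countable \<P>" unfolding \<P>_def by simp
  have pert: "\<exists>g d. continuous_map X euclidean g \<and> near (topspace X) \<epsilon> f g \<and> d > 0 \<and>
      (\<forall>h. continuous_map X euclidean h \<longrightarrow> near (topspace X) d g h \<longrightarrow> P h)"
    if P: "P \<in> \<P>" and f: "continuous_map X euclidean f" and \<epsilon>: "\<epsilon> > 0" for P f \<epsilon>
  proof -
    consider m where "P = interior_values_stable X m" | m where "P = stable_values_split X m"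
      | F where "P = multiple_values_stable X F" "F \<in> \<F>"
      using P unfolding \<P>_def by blast
    then show ?thesis
    proof cases
      case 1
      have pos: "inverse (real (Suc m)) > 0" by simp
      obtain g d where
        "continuous_map X euclidean g" "near (topspace X) \<epsilon> f g" "d > 0"
        "\<And>h y. continuous_map X euclidean h \<Longrightarrow> near (topspace X) d g h \<Longrightarrow>
          ball y (inverse (real (Suc m))) \<subseteq> h ` topspace X \<Longrightarrow> \<exists>b>0. stable_value X h (topspace X) y b"
        by (rule interior_value_perturbation[OF X f \<epsilon> pos]) blast
      then show ?thesis
        unfolding 1 interior_values_stable_def by (intro exI[of _ g] exI[of _ d]) simp
    next
      case 2
      have pos: "inverse (real (Suc m)) > 0" by simp
      obtain g d where
        "continuous_map X euclidean g" "near (topspace X) \<epsilon> f g" "d > 0"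
        "\<And>h C y. continuous_map X euclidean h \<Longrightarrow> near (topspace X) d g h \<Longrightarrow> closedin X C \<Longrightarrow>
          stable_value X h C y (inverse (real (Suc m))) \<Longrightarrow>
          \<exists>C1 C2 d'. closedin X C1 \<and> closedin X C2 \<and> C1 \<subseteq> C \<and> C2 \<subseteq> C \<and> C1 \<inter> C2 = {} \<and> d' > 0 \<and>
            stable_value X h C1 y d' \<and> stable_value X h C2 y d'"
        by (rule stable_value_splitting_perturbation[OF f \<epsilon> pos]) blast
      then show ?thesis
        unfolding 2 stable_values_split_def by (intro exI[of _ g] exI[of _ d]) simp
    next
      case 3
      have cl: "closedin X (F i)" if "i \<le> CARD('n)" for i
        using 3(2) \<B>(2) that by (auto simp: \<F>_def separated_families_def)
      have dj: "disjnt (F i) (F j)" if "i \<le> CARD('n)" "j \<le> CARD('n)" "i \<noteq> j" for i j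
        using 3(2) that by (simp add: \<F>_def separated_families_def)
      obtain g d where
        "continuous_map X euclidean g" "near (topspace X) \<epsilon> f g" "d > 0"
        "\<And>h y. continuous_map X euclidean h \<Longrightarrow> near (topspace X) d g h \<Longrightarrow>
          (\<And>i. i \<le> CARD('n) \<Longrightarrow> y \<in> h ` F i) \<Longrightarrow> \<exists>b>0. stable_value X h (topspace X) y b"
        by (rule multiple_value_perturbation[where K = F, OF X nX f \<epsilon> cl dj]) blast+
      then show ?thesis
        unfolding 3 multiple_values_stable_def by (intro exI[of _ g] exI[of _ d]) simp
    qed
  qed
  have "generic_in C.mtopology
    (\<lambda>f. (\<forall>y \<in> frontier (f ` mspace K). finite (fibre K f y) \<and> card (fibre K f y) \<le> CARD('n)) \<and>
         (\<forall>y \<in> interior (f ` mspace K). fibre K f y \<approx> (UNIV :: nat set set)))"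
  proof (rule C.generic_in_mtopologyI[OF count])
    fix P f and \<epsilon> :: real assume "P \<in> \<P>" "f \<in> mspace ?C" "\<epsilon> > 0"
    then show "\<exists>g\<in>mspace ?C. mdist ?C f g < \<epsilon> \<and> (\<exists>\<delta>>0. \<forall>h\<in>mspace ?C. mdist ?C g h < \<delta> \<longrightarrow> P h)"
      using cfunspace_perturbation[OF X pert] by simp
  next
    fix h assume hC: "h \<in> mspace ?C" and all: "\<And>P. P \<in> \<P> \<Longrightarrow> P h"
    have h: "continuous_map X euclidean h" using hC by simp
    have fib: "fibre K h y = {x \<in> topspace X. h x = y}" for y by (simp add: fibre_def tX)
    have "finite (fibre K h y) \<and> card (fibre K h y) \<le> CARD('n)" if y: "y \<in> frontier (h ` mspace K)" for y
    proof (rule ccontr)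
      assume large: "\<not> ?thesis"
      have "\<exists>S\<subseteq>fibre K h y. finite S \<and> card S = Suc CARD('n)"
      proof (cases "finite (fibre K h y)")
        case True
        then have "Suc CARD('n) \<le> card (fibre K h y)" using large by simp
        then show ?thesis using obtain_subset_with_card_n by metis
      next
        case False
        then show ?thesis using infinite_arbitrarily_large by metis
      qed
      then obtain S where S: "S \<subseteq> fibre K h y" "finite S" "card S = Suc CARD('n)" by blast
      have SK: "S \<subseteq> mspace K" using S(1) by (auto simp: fibre_def)
      obtain \<beta> where \<beta>: "\<forall>x\<in>S. \<beta> x \<in> \<B> \<and> x \<in> \<beta> x" "\<forall>x\<in>S. \<forall>y\<in>S. x \<noteq> y \<longrightarrow> disjnt (\<beta> x) (\<beta> y)"
        using sp[rule_format, OF S(2) SK] by (elim exE conjE)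
      obtain e where e: "bij_betw e {0..<Suc CARD('n)} S"
        using ex_bij_betw_nat_finite[OF S(2)] S(3) by auto
      have eS: "e i \<in> S" if "i \<le> CARD('n)" for i
        using bij_betwE[OF e] that by auto
      have einj: "e i \<noteq> e j" if "i \<le> CARD('n)" "j \<le> CARD('n)" "i \<noteq> j" for i j
        using bij_betw_imp_inj_on[OF e] that by (auto dest: inj_onD)
      \<comment> \<open>Disjoint members of \<open>\<B>\<close> around the
        \<open>CARD('n) + 1\<close> chosen preimages.\<close>
      define F where "F = restrict (\<lambda>i. \<beta> (e i)) {..CARD('n)}"
      have "F \<in> \<F>"
        unfolding \<F>_def separated_families_def F_def using \<beta> eS einj by auto
      then have "multiple_values_stable X F \<in> \<P>" unfolding \<P>_def by blast
      then have "multiple_values_stable X F h" by (rule all)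
      moreover have "y \<in> h ` F i" if i: "i \<le> CARD('n)" for i
      proof (rule image_eqI)
        show "y = h (e i)" using eS[OF i] S(1) by (auto simp: fibre_def)
        show "e i \<in> F i" using eS[OF i] \<beta>(1) i by (simp add: F_def)
      qed
      ultimately obtain b where "b > 0" "stable_value X h (topspace X) y b"
        unfolding multiple_values_stable_def by blast
      \<comment> \<open>A stable value is interior, which the frontier excludes.\<close>
      then have "y \<in> interior (h ` mspace K)"
        using stable_value_imp_interior[OF _ _ h] tX by simp
      then show False using y by (simp add: frontier_def)
    qed
    moreover have "fibre K h y \<approx> (UNIV :: nat set set)" if y: "y \<in> interior (h ` mspace K)" for y
    proof (rule lepoll_antisym)
      have "fibre K h y \<lesssim> mspace K" by (rule subset_imp_lepoll) (auto simp: fibre_def)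
      then show "fibre K h y \<lesssim> (UNIV :: nat set set)"
        by (rule lepoll_trans) (rule K.compact_lepoll_continuum[OF X[unfolded XK]])
      have P: "interior_values_stable X m \<in> \<P>" "stable_values_split X m \<in> \<P>" for m
        unfolding \<P>_def by blast+
      then show "(UNIV :: nat set set) \<lesssim> fibre K h y"
        unfolding fib using interior_fibre_lepoll[OF X h all[OF P(1)] all[OF P(2)]] y tX by simp
    qed
    ultimately show "(\<forall>y \<in> frontier (h ` mspace K). finite (fibre K h y) \<and> card (fibre K h y) \<le> CARD('n)) \<and>
         (\<forall>y \<in> interior (h ` mspace K). fibre K h y \<approx> (UNIV :: nat set set))" by blast
  qed
  then show ?thesis by (simp add: X_def mtopology_of_def)
qed

end
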